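(* Let $f=(f_1,\dots,f_n):\mathbb{R}^n\to\mathbb{R}^n$ be a real polynomial mapping which is $\mathcal{D}_0$. On input $f$, Algorithm A (described in the context) terminates and returns a univariate representation of the solution set $\mathrm{Sol}(f)$.
   Context: For a real polynomial mapping $f=(f_1,\dots,f_n):\mathbb{R}^n\to\mathbb{R}^n$, $\mathrm{Sol}(f)$ denotes the solution set of the polynomial complementarity problem $\mathrm{CP}(f)$, i.e. the set of $x\in\mathbb{R}^n$ with $x\ge0$, $f(x)\ge0$ (componentwise) and $\langle x\mid f(x)\rangle=0$ (usual scalar product). $f$ is called $\mathcal{D}_0$ if the set $\{x\in\mathbb{C}^n:x_1f_1(x)=\dots=x_nf_n(x)=0\}$ is finite. With $x=(x_1,\dots,x_n)$ and $z=(z_1,\dots,z_{2n})$, $\mathcal{I}[f,z]$ is the ideal of $\mathbb{R}[x,z]$ generated by the $3n$ polynomials $$x_1f_1,\dots,x_nf_n,\ z_1^2-x_1,\dots,z_n^2-x_n,\ z_{n+1}^2-f_1,\dots,z_{2n}^2-f_n,\qquad( * )$$ and $V_{\mathbb{C}}(\mathcal{I}[f,z])\subseteq\mathbb{C}^{3n}$ is its set of common complex zeros. A univariate representation of $\mathrm{Sol}(f)$ (for $f$ being $\mathcal{D}_0$) is a system $[w,v_1,\dots,v_n]\subset\mathbb{R}[t]$ with $\deg w=\#V_{\mathbb{C}}(\mathcal{I}[f,z])$, $\deg v_i<\deg w$ for all $i$, and $\mathrm{Sol}(f)=\{(v_1(t),\dots,v_n(t)): w(t)=0,\ t\in\mathbb{R}\}$.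 Algorithm A. Start with $s:=0$ and repeat the following loop. (i) Let $H\in\mathbb{R}^{3n\times3n}$ be the inverse of the matrix whose first row is $(1,s,s^2,\dots,s^{3n-1})$ and whose other rows are those of the identity matrix. Change variables by $(x,z)=Hy$, $y=(y_1,\dots,y_{3n})$ (vectors regarded as columns), in the polynomials $( * )$ to obtain, respectively, $h_1(y),\dots,h_{3n}(y)$. (ii) Let $\mathcal{I}_h=\langle h_1,\dots,h_{3n}\rangle\subset\mathbb{R}[y_1,\dots,y_{3n}]$ and compute the reduced Gröbner basis $G$ of its radical $\mathrm{rad}(\mathcal{I}_h)$ with respect to the pure lexicographic ordering with $y_1<y_2<\dots<y_{3n}$. (iii) If $G$ has the form $G=[w,y_2-u_2,\dots,y_{3n}-u_{3n}]$ with $w,u_2,\dots,u_{3n}\in\mathbb{R}[y_1]$, exit the loop; otherwise set $s:=s+1$ and repeat. After the loop, rename $y_1$ as $t$, let $(v_1,\dots,v_n)$ be the first $n$ coordinates of $H(t,u_2,\dots,u_{3n})^T$, and return $[w,v_1,\dots,v_n]$.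
   Formalization: If V_C(I[f,z]) is a single point (e.g. n=1, f=x), Algorithm A returns w=t, v_1=t, so deg v_1<deg w fails and the claim is false as stated; in that case only, the result is asserted for the output with each v_i replaced by its remainder modulo w. *)

theory Defs
  imports
    Complex_Main
    "HOL-Library.Poly_Mapping"
    "HOL-Library.While_Combinator"
    "HOL-Algebra.Ideal"
    "HOL-Computational_Algebra.Polynomial"
    "Jordan_Normal_Form.Gauss_Jordan_Elimination"
begin

section \<open>Multivariate polynomials\<close>

text \<open>Monomials are finitely supported exponent functions on the variable indices, and polynomials
  are finitely supported coefficient functions on the monomials. Indices start at 0: the
  mathematical variables \<open>x\<^sub>1, \<dots>, x\<^sub>N\<close> are \<open>MVar 0, \<dots>, MVar (N - 1)\<close>.\<close>

type_synonym 'a mpoly = "(nat \<Rightarrow>\<^sub>0 nat) \<Rightarrow>\<^sub>0 'a"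

definition MVar :: "nat \<Rightarrow> 'a::comm_ring_1 mpoly" where
  "MVar i = Poly_Mapping.single (Poly_Mapping.single i 1) 1"

definition MConst :: "'a::comm_ring_1 \<Rightarrow> 'a mpoly" where
  "MConst c = Poly_Mapping.single 0 c"

definition mvars :: "'a::comm_ring_1 mpoly \<Rightarrow> nat set" where
  "mvars p = (\<Union>m\<in>Poly_Mapping.keys p. Poly_Mapping.keys m)"

text \<open>Substitute \<open>a i\<close> for the variable \<open>i\<close>, mapping the coefficients by \<open>\<phi>\<close>.\<close>

definition mpoly_eval ::
    "('a::comm_ring_1 \<Rightarrow> 'b::comm_ring_1) \<Rightarrow> (nat \<Rightarrow> 'b) \<Rightarrow> 'a mpoly \<Rightarrow> 'b" where
  "mpoly_eval \<phi> a p =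
    (\<Sum>m\<in>Poly_Mapping.keys p.
       \<phi> (Poly_Mapping.lookup p m) * (\<Prod>i\<in>Poly_Mapping.keys m. a i ^ Poly_Mapping.lookup m i))"

definition real_eval :: "real mpoly \<Rightarrow> real vec \<Rightarrow> real" where
  "real_eval p x = mpoly_eval (\<lambda>c. c) (\<lambda>i. x $ i) p"

definition complex_eval :: "real mpoly \<Rightarrow> complex vec \<Rightarrow> complex" where
  "complex_eval p x = mpoly_eval complex_of_real (\<lambda>i. x $ i) p"

text \<open>The polynomial ring in the first \<open>N\<close> variables.\<close>

definition mpoly_ring :: "nat \<Rightarrow> 'a::comm_ring_1 mpoly ring" where
  "mpoly_ring N = \<lparr>carrier = {p. mvars p \<subseteq> {..<N}}, monoid.mult = (*), one = 1, zero = 0, add = (+)\<rparr>"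

definition radical :: "nat \<Rightarrow> 'a::comm_ring_1 mpoly set \<Rightarrow> 'a mpoly set" where
  "radical N I = {p \<in> carrier (mpoly_ring N). \<exists>k\<ge>1. p ^ k \<in> I}"

definition complex_zeros :: "nat \<Rightarrow> real mpoly set \<Rightarrow> complex vec set" where
  "complex_zeros N I = {a \<in> carrier_vec N. \<forall>p\<in>I. complex_eval p a = 0}"

section \<open>Reduced Groebner bases for the lexicographic ordering\<close>

text \<open>Lexicographic ordering in which variables with larger index are larger. The built-in
  ordering on finitely supported functions is the opposite one: there variable 0 is the largest.\<close>

definition lex_less :: "(nat \<Rightarrow>\<^sub>0 nat) \<Rightarrow> (nat \<Rightarrow>\<^sub>0 nat) \<Rightarrow> bool" where
  "lex_less m m' \<longleftrightarrow>
    (\<exists>k. Poly_Mapping.lookup m k < Poly_Mapping.lookup m' k \<and>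
         (\<forall>j>k. Poly_Mapping.lookup m j = Poly_Mapping.lookup m' j))"

definition mono_dvd :: "(nat \<Rightarrow>\<^sub>0 nat) \<Rightarrow> (nat \<Rightarrow>\<^sub>0 nat) \<Rightarrow> bool" where
  "mono_dvd m m' \<longleftrightarrow> (\<forall>i. Poly_Mapping.lookup m i \<le> Poly_Mapping.lookup m' i)"

text \<open>Only meaningful for \<open>p \<noteq> 0\<close>.\<close>

definition lead_mono :: "'a::comm_ring_1 mpoly \<Rightarrow> (nat \<Rightarrow>\<^sub>0 nat)" where
  "lead_mono p =
    (THE m. m \<in> Poly_Mapping.keys p \<and> (\<forall>m'\<in>Poly_Mapping.keys p. m' \<noteq> m \<longrightarrow> lex_less m' m))"

definition is_groebner_basis :: "'a::comm_ring_1 mpoly set \<Rightarrow> 'a mpoly set \<Rightarrow> bool" where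
  "is_groebner_basis G I \<longleftrightarrow>
    finite G \<and> G \<subseteq> I \<and> 0 \<notin> G \<and>
    (\<forall>p\<in>I. p \<noteq> 0 \<longrightarrow> (\<exists>g\<in>G. mono_dvd (lead_mono g) (lead_mono p)))"

definition is_reduced_groebner_basis :: "'a::comm_ring_1 mpoly set \<Rightarrow> 'a mpoly set \<Rightarrow> bool" where
  "is_reduced_groebner_basis G I \<longleftrightarrow>
    is_groebner_basis G I \<and>
    (\<forall>g\<in>G. Poly_Mapping.lookup g (lead_mono g) = 1) \<and>
    (\<forall>g\<in>G. \<forall>h\<in>G - {g}. \<forall>m\<in>Poly_Mapping.keys g. \<not> mono_dvd (lead_mono h) m)"

text \<open>Over a field, every ideal of \<open>mpoly_ring N\<close> has exactly one reduced Groebner basis.\<close>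

definition reduced_groebner_basis :: "'a::field mpoly set \<Rightarrow> 'a mpoly set" where
  "reduced_groebner_basis I = (THE G. is_reduced_groebner_basis G I)"

section \<open>Polynomial complementarity problems\<close>

text \<open>A polynomial mapping of real \<open>n\<close>-space is given by its components \<open>f 0, \<dots>, f (n - 1)\<close>.\<close>

definition polynomial_mapping :: "nat \<Rightarrow> (nat \<Rightarrow> real mpoly) \<Rightarrow> bool" where
  "polynomial_mapping n f \<longleftrightarrow> (\<forall>i<n. f i \<in> carrier (mpoly_ring n))"

definition Sol :: "nat \<Rightarrow> (nat \<Rightarrow> real mpoly) \<Rightarrow> real vec set" where
  "Sol n f =
    {x \<in> carrier_vec n. (\<forall>i<n. x $ i \<ge> 0) \<and> (\<forall>i<n. real_eval (f i) x \<ge> 0) \<and>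
       x \<bullet> vec n (\<lambda>i. real_eval (f i) x) = 0}"

definition D0 :: "nat \<Rightarrow> (nat \<Rightarrow> real mpoly) \<Rightarrow> bool" where
  "D0 n f \<longleftrightarrow> finite {x \<in> carrier_vec n. \<forall>i<n. x $ i * complex_eval (f i) x = 0}"

text \<open>The generators of \<open>I[f,z]\<close>. The variables \<open>0, \<dots>, n - 1\<close> are the \<open>x\<close>-variables and
  \<open>n, \<dots>, 3 n - 1\<close> are the \<open>z\<close>-variables, so the last \<open>n\<close> indices are \<open>z\<^sub>n\<^sub>+\<^sub>1, \<dots>, z\<^sub>2\<^sub>n\<close>.\<close>

definition cp_generators :: "nat \<Rightarrow> (nat \<Rightarrow> real mpoly) \<Rightarrow> real mpoly list" where
  "cp_generators n f =
    map (\<lambda>i. MVar i * f i) [0..<n] @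
    map (\<lambda>i. (MVar (n + i))\<^sup>2 - MVar i) [0..<n] @
    map (\<lambda>i. (MVar (2 * n + i))\<^sup>2 - f i) [0..<n]"

definition cp_ideal :: "nat \<Rightarrow> (nat \<Rightarrow> real mpoly) \<Rightarrow> real mpoly set" where
  "cp_ideal n f = Idl\<^bsub>mpoly_ring (3 * n)\<^esub> (set (cp_generators n f))"

definition cp_variety :: "nat \<Rightarrow> (nat \<Rightarrow> real mpoly) \<Rightarrow> complex vec set" where
  "cp_variety n f = complex_zeros (3 * n) (cp_ideal n f)"

definition univariate_representation ::
    "nat \<Rightarrow> (nat \<Rightarrow> real mpoly) \<Rightarrow> real poly \<Rightarrow> real poly list \<Rightarrow> bool" where
  "univariate_representation n f w vs \<longleftrightarrow>
    length vs = n \<and>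
    degree w = card (cp_variety n f) \<and>
    (\<forall>i<n. degree (vs ! i) < degree w) \<and>
    Sol n f = {vec n (\<lambda>i. poly (vs ! i) t) | t. poly w t = 0}"

section \<open>The algorithm\<close>

definition step_matrix :: "nat \<Rightarrow> nat \<Rightarrow> real mat" where
  "step_matrix N s =
    mat N N (\<lambda>(i, j). if i = 0 then real s ^ j else if i = j then 1 else 0)"

text \<open>The matrix is unitriangular, so \<open>mat_inverse\<close> never returns \<open>None\<close> here.\<close>

definition H_matrix :: "nat \<Rightarrow> nat \<Rightarrow> real mat" where
  "H_matrix N s = the (mat_inverse (step_matrix N s))"

definition change_vars :: "nat \<Rightarrow> real mat \<Rightarrow> real mpoly \<Rightarrow> real mpoly" where
  "change_vars N H p =
    mpoly_eval MConst (\<lambda>i. (map_mat MConst H *\<^sub>v vec N MVar) $ i) p"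

definition step_ideal :: "nat \<Rightarrow> (nat \<Rightarrow> real mpoly) \<Rightarrow> nat \<Rightarrow> real mpoly set" where
  "step_ideal n f s =
    Idl\<^bsub>mpoly_ring (3 * n)\<^esub> (change_vars (3 * n) (H_matrix (3 * n) s) ` set (cp_generators n f))"

definition step_basis :: "nat \<Rightarrow> (nat \<Rightarrow> real mpoly) \<Rightarrow> nat \<Rightarrow> real mpoly set" where
  "step_basis n f s = reduced_groebner_basis (radical (3 * n) (step_ideal n f s))"

text \<open>A univariate polynomial, read as a polynomial in the first variable \<open>y\<^sub>1\<close>.\<close>

definition in_y1 :: "real poly \<Rightarrow> real mpoly" where
  "in_y1 p = poly (map_poly MConst p) (MVar 0)"

text \<open>\<open>G = [w, y\<^sub>2 - u\<^sub>2, \<dots>, y\<^sub>N - u\<^sub>N]\<close>, where \<open>us = [u\<^sub>2, \<dots>, u\<^sub>N]\<close>.\<close>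

definition has_shape :: "nat \<Rightarrow> real mpoly set \<Rightarrow> real poly \<times> real poly list \<Rightarrow> bool" where
  "has_shape N G = (\<lambda>(w, us).
    length us = N - 1 \<and>
    G = set (in_y1 w # map (\<lambda>j. MVar (j + 1) - in_y1 (us ! j)) [0..<N - 1]))"

text \<open>The list \<open>[v\<^sub>1, \<dots>, v\<^sub>n]\<close> of the first \<open>n\<close> coordinates of \<open>H (t, u\<^sub>2, \<dots>, u\<^sub>3\<^sub>n)\<close>;
  the polynomial \<open>[:0, 1:]\<close> is \<open>t\<close>.\<close>

definition output_polys :: "nat \<Rightarrow> nat \<Rightarrow> real poly list \<Rightarrow> real poly list" where
  "output_polys n s us =
    map (\<lambda>i. (map_mat (\<lambda>c. [:c:]) (H_matrix (3 * n) s) *\<^sub>v vec_of_list ([:0, 1:] # us)) $ i) [0..<n]"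

text \<open>The result is \<open>None\<close> iff the loop does not terminate.\<close>

definition algorithm_A :: "nat \<Rightarrow> (nat \<Rightarrow> real mpoly) \<Rightarrow> (real poly \<times> real poly list) option" where
  "algorithm_A n f =
    map_option
      (\<lambda>s. let (w, us) = (THE wu. has_shape (3 * n) (step_basis n f s) wu)
           in (w, output_polys n s us))
      (while_option (\<lambda>s. \<nexists>wu. has_shape (3 * n) (step_basis n f s) wu) (\<lambda>s. s + 1) 0)"

text \<open>A degenerate case: if the variety is a single point, that point is 0, the Groebner basis is
  \<open>[y\<^sub>1, \<dots>, y\<^sub>3\<^sub>n]\<close> already for \<open>s = 0\<close>, and the algorithm returns \<open>[t, t, 0, \<dots>, 0]\<close>. For instance
  this happens for \<open>n = 1\<close> and \<open>f\<^sub>1 = x\<^sub>1\<close>. There \<open>degree v\<^sub>1 = degree w = 1\<close>, so the strict degree bound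
  of \<open>univariate_representation\<close> only holds once the \<open>v\<^sub>i\<close> are reduced modulo \<open>w\<close>, which does not
  change their values at the roots of \<open>w\<close>. With at least two points, the output already satisfies
  the bound.\<close>

end

theory Submission
  imports Defs "HOL-Analysis.Continuum_Not_Denumerable" "Jordan_Normal_Form.Char_Poly"
begin

text \<open>Write \<open>N = 3 n\<close> and let \<open>V\<close> be the set of common complex zeros of the generators in \<open>N\<close>-space.
  It is finite, because \<open>x\<close> ranges over the finite set provided by \<open>D0\<close> and every \<open>z\<^sub>i\<close> is a square root
  of a quantity determined by \<open>x\<close>; it is nonempty, because \<open>x = 0\<close> can always be completed; and it is
  closed under complex conjugation, because the generators are real. The change of variables in round
  \<open>s\<close> moves \<open>V\<close> by an invertible real matrix to a set \<open>V\<^sub>s\<close>, and the first coordinate of the point coming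
  from \<open>a\<close> is \<open>\<Sum>\<^sub>j s\<^sup>j a\<^sub>j\<close>.

  By the Nullstellensatz (\<open>radical_eq_vanishing\<close>) the radical of the transformed ideal consists of all
  real polynomials that vanish on \<open>V\<^sub>s\<close>, so the outcome of a round depends only on this finite set. If
  the first coordinate is injective on \<open>V\<^sub>s\<close>, the reduced Groebner basis can be written down
  (\<open>shape_lemma\<close>): \<open>w\<close> is the product of \<open>t - a\<^sub>1\<close> over the points \<open>a\<close>, and \<open>u\<^sub>j\<close> interpolates the \<open>j\<close>-th
  coordinate as a function of the first one; conjugation invariance makes these polynomials real. If
  conversely the basis has the required shape, then \<open>y\<^sub>j - u\<^sub>j(y\<^sub>1)\<close> vanishes on \<open>V\<^sub>s\<close>, so the first
  coordinate determines the whole point and is injective (\<open>has_shape_imp_separating\<close>). This converse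
  reads off members of the ideal from the basis, and so it depends on a reduced Groebner basis existing
  in every round, not only in the successful one.

  The loop therefore stops exactly when the first coordinate separates the points. Two different points
  of \<open>V\<close> get the same first coordinate only if \<open>s\<close> is a root of the nonzero polynomial with coefficients
  \<open>a\<^sub>j - b\<^sub>j\<close>, so only finitely many \<open>s\<close> are bad and the loop ends. After it, the real roots \<open>t\<close> of \<open>w\<close> are
  the first coordinates of the real points of \<open>V\<^sub>s\<close>: the remaining coordinates \<open>u\<^sub>j(t)\<close> are then real as
  well. Applying \<open>H\<close> gives precisely the real points \<open>(x, z)\<close> of \<open>V\<close>, and \<open>x\<close> extends to a real point of
  \<open>V\<close> iff \<open>x\<close> and \<open>f(x)\<close> are componentwise nonnegative with products zero, i.e. iff \<open>x\<close> is a solution.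

  The Nullstellensatz is proved over the complex numbers by a counting argument: an ideal that is maximal
  among those avoiding the powers of \<open>p\<close> contains some \<open>x\<^sub>i - a\<close> for every variable \<open>x\<^sub>i\<close>, since otherwise
  there would be uncountably many polynomials, one for each \<open>a\<close>, that are linearly independent in a space of
  countable dimension (\<open>variable_constant_modulo_ideal\<close>).\<close>

section \<open>Evaluation of multivariate polynomials\<close>

definition mono_eval :: "(nat \<Rightarrow> 'b::comm_ring_1) \<Rightarrow> (nat \<Rightarrow>\<^sub>0 nat) \<Rightarrow> 'b" where
  "mono_eval a m = (\<Prod>i\<in>Poly_Mapping.keys m. a i ^ Poly_Mapping.lookup m i)"

lemma mono_eval_superset:
  assumes "finite S" "Poly_Mapping.keys m \<subseteq> S"
  shows "mono_eval a m = (\<Prod>i\<in>S. a i ^ Poly_Mapping.lookup m i)"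
  unfolding mono_eval_def using assms
  by (intro prod.mono_neutral_left) (auto simp: in_keys_iff)

lemma mono_eval_zero [simp]: "mono_eval a 0 = 1"
  by (simp add: mono_eval_def)

lemma mono_eval_add: "mono_eval a (m + m') = mono_eval a m * mono_eval a m'"
proof -
  let ?S = "Poly_Mapping.keys m \<union> Poly_Mapping.keys m'"
  have "mono_eval a (m + m') = (\<Prod>i\<in>?S. a i ^ Poly_Mapping.lookup (m + m') i)"
    by (intro mono_eval_superset) (auto simp: keys_add)
  also have "\<dots> = (\<Prod>i\<in>?S. a i ^ Poly_Mapping.lookup m i) * (\<Prod>i\<in>?S. a i ^ Poly_Mapping.lookup m' i)"
    by (simp add: lookup_add power_add prod.distrib)
  also have "\<dots> = mono_eval a m * mono_eval a m'"
    by (subst (1 2) mono_eval_superset[where S = ?S]) auto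
  finally show ?thesis .
qed

lemma mono_eval_single: "mono_eval a (Poly_Mapping.single i k) = a i ^ k"
  by (simp add: mono_eval_def)

lemma mpoly_eval_superset:
  assumes "finite S" "Poly_Mapping.keys p \<subseteq> S" "\<phi> 0 = 0"
  shows "mpoly_eval \<phi> a p = (\<Sum>m\<in>S. \<phi> (Poly_Mapping.lookup p m) * mono_eval a m)"
  unfolding mpoly_eval_def mono_eval_def[symmetric] using assms
  by (intro sum.mono_neutral_left) (auto simp: in_keys_iff)

lemma mpoly_eval_single:
  assumes "\<phi> 0 = 0"
  shows "mpoly_eval \<phi> a (Poly_Mapping.single m c) = \<phi> c * mono_eval a m"
  by (subst mpoly_eval_superset[of "{m}"]) (auto simp: assms)

lemma mpoly_as_sum_of_terms:
  "(p :: 'a::comm_ring_1 mpoly) =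
     (\<Sum>m\<in>Poly_Mapping.keys p. Poly_Mapping.single m (Poly_Mapping.lookup p m))"
  by (rule poly_mapping_eqI)
    (auto simp: lookup_sum lookup_single when_def in_keys_iff sum.delta)

lemma comm_ring_hom_mpoly_eval:
  assumes "comm_ring_hom (\<phi> :: 'a::comm_ring_1 \<Rightarrow> 'b::comm_ring_1)"
  shows "comm_ring_hom (mpoly_eval \<phi> a)"
proof -
  interpret comm_ring_hom \<phi> by fact
  have add: "mpoly_eval \<phi> a (p + q) = mpoly_eval \<phi> a p + mpoly_eval \<phi> a q" for p q
  proof -
    let ?S = "Poly_Mapping.keys p \<union> Poly_Mapping.keys q"
    have "mpoly_eval \<phi> a (p + q) = (\<Sum>m\<in>?S. \<phi> (Poly_Mapping.lookup (p + q) m) * mono_eval a m)"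
      by (intro mpoly_eval_superset) (auto dest: subsetD[OF keys_add])
    also have "\<dots> = (\<Sum>m\<in>?S. \<phi> (Poly_Mapping.lookup p m) * mono_eval a m)
        + (\<Sum>m\<in>?S. \<phi> (Poly_Mapping.lookup q m) * mono_eval a m)"
      by (simp add: lookup_add hom_add distrib_right sum.distrib)
    also have "\<dots> = mpoly_eval \<phi> a p + mpoly_eval \<phi> a q"
      by (subst (1 2) mpoly_eval_superset[where S = ?S]) auto
    finally show ?thesis .
  qed
  have zero: "mpoly_eval \<phi> a 0 = 0"
    by (simp add: mpoly_eval_def)
  have sum: "mpoly_eval \<phi> a (sum g X) = (\<Sum>x\<in>X. mpoly_eval \<phi> a (g x))" for g :: "'c \<Rightarrow> 'a mpoly" and X
    by (induction X rule: infinite_finite_induct) (auto simp: add zero)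
  have mult: "mpoly_eval \<phi> a (p * q) = mpoly_eval \<phi> a p * mpoly_eval \<phi> a q" for p q
  proof -
    let ?s = "\<lambda>r m. Poly_Mapping.single m (Poly_Mapping.lookup r m)"
    have "p * q = (\<Sum>m\<in>Poly_Mapping.keys p. ?s p m) * (\<Sum>m\<in>Poly_Mapping.keys q. ?s q m)"
      using mpoly_as_sum_of_terms[of p] mpoly_as_sum_of_terms[of q] by simp
    also have "\<dots> = (\<Sum>m\<in>Poly_Mapping.keys p. \<Sum>m'\<in>Poly_Mapping.keys q. ?s p m * ?s q m')"
      by (simp add: sum_product)
    finally have "mpoly_eval \<phi> a (p * q) =
        (\<Sum>m\<in>Poly_Mapping.keys p. \<Sum>m'\<in>Poly_Mapping.keys q. mpoly_eval \<phi> a (?s p m * ?s q m'))"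
      by (simp add: sum)
    also have "\<dots> = (\<Sum>m\<in>Poly_Mapping.keys p. \<Sum>m'\<in>Poly_Mapping.keys q.
        (\<phi> (Poly_Mapping.lookup p m) * mono_eval a m) * (\<phi> (Poly_Mapping.lookup q m') * mono_eval a m'))"
      by (simp add: mult_single mpoly_eval_single hom_mult mono_eval_add mult_ac)
    also have "\<dots> = mpoly_eval \<phi> a p * mpoly_eval \<phi> a q"
      by (simp add: mpoly_eval_def mono_eval_def sum_product)
    finally show ?thesis .
  qed
  have one: "mpoly_eval \<phi> a 1 = 1"
    using mpoly_eval_single[of \<phi> a 0 1] by simp
  show ?thesis
    by standard (auto simp: add mult zero one)
qed

lemma mpoly_eval_MConst: "\<phi> 0 = 0 \<Longrightarrow> mpoly_eval \<phi> a (MConst c) = \<phi> c"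
  by (simp add: MConst_def mpoly_eval_single)

lemma mpoly_eval_MVar: "\<phi> 0 = 0 \<Longrightarrow> \<phi> 1 = 1 \<Longrightarrow> mpoly_eval \<phi> a (MVar i) = a i"
  by (simp add: MVar_def mpoly_eval_single mono_eval_single)

lemma MConst_0 [simp]: "MConst 0 = 0"
  and MConst_1 [simp]: "MConst 1 = 1"
  by (simp_all add: MConst_def)

lemma MConst_eq_0_iff [simp]: "MConst c = 0 \<longleftrightarrow> c = 0"
  unfolding MConst_def by (metis inj_single injD single_zero)

lemma comm_ring_hom_MConst: "comm_ring_hom (MConst :: 'a::comm_ring_1 \<Rightarrow> 'a mpoly)"
  by standard (simp_all add: MConst_def single_add mult_single)

interpretation MConst_hom: comm_ring_hom "MConst :: 'a::comm_ring_1 \<Rightarrow> 'a mpoly"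
  by (rule comm_ring_hom_MConst)

lemma MVar_power: "(MVar i :: 'a::comm_ring_1 mpoly) ^ k = Poly_Mapping.single (Poly_Mapping.single i k) 1"
  by (induction k) (auto simp: MVar_def mult_single single_add[symmetric])

lemma mono_eval_MVar: "mono_eval MVar m = (Poly_Mapping.single m 1 :: 'a::comm_ring_1 mpoly)"
proof -
  have "(\<Prod>i\<in>S. (MVar i :: 'a mpoly) ^ Poly_Mapping.lookup m i)
      = Poly_Mapping.single (\<Sum>i\<in>S. Poly_Mapping.single i (Poly_Mapping.lookup m i)) 1" if "finite S" for S
    using that by (induction S rule: finite_induct) (auto simp: MVar_power mult_single)
  moreover have "(\<Sum>i\<in>Poly_Mapping.keys m. Poly_Mapping.single i (Poly_Mapping.lookup m i)) = m"
    by (rule poly_mapping_eqI) (auto simp: lookup_sum lookup_single when_def in_keys_iff sum.delta)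
  ultimately show ?thesis
    by (simp add: mono_eval_def)
qed

lemma mpoly_eval_MConst_MVar: "mpoly_eval MConst MVar p = p"
proof -
  have "mpoly_eval MConst MVar p
      = (\<Sum>m\<in>Poly_Mapping.keys p. Poly_Mapping.single m (Poly_Mapping.lookup p m))"
    unfolding mpoly_eval_def mono_eval_def[symmetric] mono_eval_MVar
    by (simp add: MConst_def mult_single)
  then show ?thesis
    using mpoly_as_sum_of_terms[of p] by simp
qed

text \<open>Polynomial identities that are compatible with sums and products are proved with this rule by
  checking constants and variables only; \<open>A\<close> restricts the variables that have to be considered.\<close>

lemma mpoly_induct [consumes 1, case_names const var add mult]:
  fixes p :: "'a::comm_ring_1 mpoly"
  assumes "mvars p \<subseteq> A" "\<And>c. P (MConst c)" "\<And>i. i \<in> A \<Longrightarrow> P (MVar i)"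
    and add: "\<And>p q. P p \<Longrightarrow> P q \<Longrightarrow> P (p + q)"
    and mult: "\<And>p q. P p \<Longrightarrow> P q \<Longrightarrow> P (p * q)"
  shows "P p"
proof -
  have P0: "P 0" and P1: "P 1"
    using assms(2)[of 0] assms(2)[of 1] by simp_all
  have sum: "P (sum g X)" if "\<And>x. x \<in> X \<Longrightarrow> P (g x)" for g :: "'c \<Rightarrow> _" and X
    using that by (induction X rule: infinite_finite_induct) (auto simp: P0 add)
  have prod: "P (prod g X)" if "\<And>x. x \<in> X \<Longrightarrow> P (g x)" for g :: "'c \<Rightarrow> _" and X
    using that by (induction X rule: infinite_finite_induct) (auto simp: P1 mult)
  have power: "P (q ^ k)" if "P q" for q k
    using that by (induction k) (auto simp: P1 mult)
  have "P (mpoly_eval MConst MVar p)"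
    unfolding mpoly_eval_def
    by (intro sum mult prod power assms(2,3)) (use assms(1) in \<open>auto simp: mvars_def\<close>)
  then show ?thesis
    by (simp add: mpoly_eval_MConst_MVar)
qed

lemma mpoly_eval_cong:
  assumes "\<And>i. i \<in> mvars p \<Longrightarrow> a i = b i"
  shows "mpoly_eval \<phi> a p = mpoly_eval \<phi> b p"
  unfolding mpoly_eval_def using assms
  by (intro sum.cong prod.cong arg_cong2[where f = "(*)"] arg_cong2[where f = "(^)"])
    (auto simp: mvars_def)

lemma hom_mpoly_eval:
  assumes "comm_ring_hom \<psi>"
  shows "\<psi> (mpoly_eval \<phi> a p) = mpoly_eval (\<lambda>c. \<psi> (\<phi> c)) (\<lambda>i. \<psi> (a i)) p"
proof -
  interpret comm_ring_hom \<psi> by fact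
  show ?thesis
    by (simp add: mpoly_eval_def hom_distribs)
qed

lemma mvars_MConst [simp]: "mvars (MConst c) = {}"
  by (auto simp: mvars_def MConst_def split: if_splits)

lemma mvars_0 [simp]: "mvars 0 = {}" and mvars_1 [simp]: "mvars 1 = {}"
  by (simp_all add: mvars_def)

lemma mvars_MVar [simp]: "mvars (MVar i :: 'a::comm_ring_1 mpoly) = {i}"
  by (auto simp: mvars_def MVar_def)

lemma mvars_add: "mvars (p + q) \<subseteq> mvars p \<union> mvars q"
  unfolding mvars_def using keys_add[of p q] by fastforce

lemma mvars_uminus [simp]: "mvars (- p) = mvars p"
proof -
  have "Poly_Mapping.keys (- p) = Poly_Mapping.keys p"
    by (auto simp: in_keys_iff)
  then show ?thesis
    by (simp add: mvars_def)
qed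

lemma mvars_diff: "mvars (p - q) \<subseteq> mvars p \<union> mvars q"
  using mvars_add[of p "- q"] by simp

lemma mvars_mult: "mvars (p * q) \<subseteq> mvars p \<union> mvars q"
proof
  fix i assume "i \<in> mvars (p * q)"
  then obtain m where m: "m \<in> Poly_Mapping.keys (p * q)" "i \<in> Poly_Mapping.keys m"
    by (auto simp: mvars_def)
  then obtain m1 m2 where *: "m = m1 + m2" "m1 \<in> Poly_Mapping.keys p" "m2 \<in> Poly_Mapping.keys q"
    using keys_mult[of p q] by auto
  with m have "i \<in> Poly_Mapping.keys m1 \<union> Poly_Mapping.keys m2"
    using keys_add[of m1 m2] by auto
  with * show "i \<in> mvars p \<union> mvars q"
    by (auto simp: mvars_def)
qed

lemma mvars_power: "mvars (p ^ k) \<subseteq> mvars p"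
proof (induction k)
  case (Suc k)
  then show ?case using mvars_mult[of p "p ^ k"] by auto
qed simp

lemma mvars_mpoly_eval:
  assumes "\<And>i. i \<in> mvars p \<Longrightarrow> mvars (a i) \<subseteq> A"
  shows "mvars (mpoly_eval MConst a p) \<subseteq> A"
proof -
  interpret comm_ring_hom "mpoly_eval MConst a"
    by (intro comm_ring_hom_mpoly_eval comm_ring_hom_MConst)
  show ?thesis
    using order_refl[of "mvars p"]
  proof (induction p rule: mpoly_induct)
    case (const c)
    show ?case by (simp add: mpoly_eval_MConst)
  next
    case (var i)
    then show ?case using assms by (simp add: mpoly_eval_MVar)
  next
    case (add p q)
    then show ?case unfolding hom_add using mvars_add by blast
  next
    case (mult p q)
    then show ?case unfolding hom_mult using mvars_mult by blast
  qed
qed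

lemma comm_ring_hom_id: "comm_ring_hom (\<lambda>c. c)"
  by standard auto

lemma comm_ring_hom_of_real: "comm_ring_hom complex_of_real"
  by standard auto

lemma comm_ring_hom_complex_eval: "comm_ring_hom (\<lambda>p. complex_eval p x)"
  unfolding complex_eval_def by (intro comm_ring_hom_mpoly_eval comm_ring_hom_of_real)

interpretation ce: comm_ring_hom "\<lambda>p. complex_eval p x"
  by (rule comm_ring_hom_complex_eval)

lemma complex_eval_MConst [simp]: "complex_eval (MConst c) x = of_real c"
  by (simp add: complex_eval_def mpoly_eval_MConst)

lemma complex_eval_MVar [simp]: "complex_eval (MVar i) x = x $ i"
  by (simp add: complex_eval_def mpoly_eval_MVar)

lemma complex_eval_of_real:
  assumes "mvars p \<subseteq> {..<dim_vec x}"
  shows "complex_eval p (map_vec of_real x) = of_real (real_eval p x)"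
proof -
  have "of_real (real_eval p x) = mpoly_eval complex_of_real (\<lambda>i. of_real (x $ i)) p"
    unfolding real_eval_def by (rule hom_mpoly_eval) (rule comm_ring_hom_of_real)
  also have "\<dots> = complex_eval p (map_vec of_real x)"
    unfolding complex_eval_def using assms by (intro mpoly_eval_cong) (auto simp: subset_iff)
  finally show ?thesis ..
qed

lemma complex_eval_cnj:
  assumes "mvars p \<subseteq> {..<dim_vec x}"
  shows "complex_eval p (map_vec cnj x) = cnj (complex_eval p x)"
proof -
  have "comm_ring_hom cnj" by standard auto
  then have "cnj (complex_eval p x) = mpoly_eval (\<lambda>c. cnj (complex_of_real c)) (\<lambda>i. cnj (x $ i)) p"
    unfolding complex_eval_def by (rule hom_mpoly_eval)
  also have "\<dots> = complex_eval p (map_vec cnj x)"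
    unfolding complex_eval_def complex_cnj_complex_of_real
    using assms by (intro mpoly_eval_cong) (auto simp: subset_iff)
  finally show ?thesis ..
qed

section \<open>Ideals of polynomial rings\<close>

lemma carrier_mpoly_ring [simp]: "carrier (mpoly_ring N) = {p. mvars p \<subseteq> {..<N}}"
  and mult_mpoly_ring [simp]: "x \<otimes>\<^bsub>mpoly_ring N\<^esub> y = x * y"
  and add_mpoly_ring [simp]: "x \<oplus>\<^bsub>mpoly_ring N\<^esub> y = x + y"
  and zero_mpoly_ring [simp]: "\<zero>\<^bsub>mpoly_ring N\<^esub> = 0"
  and one_mpoly_ring [simp]: "\<one>\<^bsub>mpoly_ring N\<^esub> = 1"
  by (simp_all add: mpoly_ring_def)

lemma cring_mpoly_ring: "cring (mpoly_ring N :: 'a::comm_ring_1 mpoly ring)"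
proof (rule cringI)
  show "abelian_group (mpoly_ring N :: 'a mpoly ring)"
  proof (rule abelian_groupI)
    fix x :: "'a mpoly" assume "x \<in> carrier (mpoly_ring N)"
    then show "\<exists>y\<in>carrier (mpoly_ring N). y \<oplus>\<^bsub>mpoly_ring N\<^esub> x = \<zero>\<^bsub>mpoly_ring N\<^esub>"
      by (intro bexI[of _ "- x"]) auto
  qed (use mvars_add in \<open>auto simp: add_ac, blast\<close>)
  show "Group.comm_monoid (mpoly_ring N :: 'a mpoly ring)"
    by (rule comm_monoidI) (use mvars_mult in \<open>auto simp: mult_ac, blast\<close>)
qed (auto simp: distrib_right)

text \<open>For the polynomial ring, whose operations are those of the type, ideals are handled through the
  closure properties below instead of the operations of the ring record.\<close>

lemma mpoly_ring_idealD:
  assumes "ideal I (mpoly_ring N)"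
  shows "I \<subseteq> {p. mvars p \<subseteq> {..<N}}" "0 \<in> I" "p \<in> I \<Longrightarrow> q \<in> I \<Longrightarrow> p + q \<in> I"
    "p \<in> I \<Longrightarrow> mvars q \<subseteq> {..<N} \<Longrightarrow> q * p \<in> I"
proof -
  interpret ideal I "mpoly_ring N" by fact
  show "I \<subseteq> {p. mvars p \<subseteq> {..<N}}" "0 \<in> I" "p \<in> I \<Longrightarrow> q \<in> I \<Longrightarrow> p + q \<in> I"
    "p \<in> I \<Longrightarrow> mvars q \<subseteq> {..<N} \<Longrightarrow> q * p \<in> I"
    using a_subset additive_subgroup.zero_closed[OF is_additive_subgroup]
      additive_subgroup.a_closed[OF is_additive_subgroup] I_l_closed by auto
qed

lemma mpoly_ring_idealI:
  fixes I :: "'a::comm_ring_1 mpoly set"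
  assumes "I \<subseteq> {p. mvars p \<subseteq> {..<N}}" "0 \<in> I" "\<And>p q. p \<in> I \<Longrightarrow> q \<in> I \<Longrightarrow> p + q \<in> I"
    "\<And>p q. p \<in> I \<Longrightarrow> mvars q \<subseteq> {..<N} \<Longrightarrow> q * p \<in> I"
  shows "ideal I (mpoly_ring N)"
proof -
  interpret cring "mpoly_ring N :: 'a mpoly ring" by (rule cring_mpoly_ring)
  show ?thesis
  proof (rule idealI)
    show "subgroup I (add_monoid (mpoly_ring N))"
    proof (rule add.subgroupI)
      fix a assume a: "a \<in> I"
      then have "a \<in> carrier (mpoly_ring N)" using assms(1) by auto
      then have "\<ominus>\<^bsub>mpoly_ring N\<^esub> a \<oplus>\<^bsub>mpoly_ring N\<^esub> a = \<zero>\<^bsub>mpoly_ring N\<^esub>" by (rule l_neg)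
      then have "\<ominus>\<^bsub>mpoly_ring N\<^esub> a = (- 1) * a"
        by (simp add: eq_neg_iff_add_eq_0)
      moreover have "(- 1) * a \<in> I" using assms(4)[OF a, of "- 1"] by simp
      ultimately show "\<ominus>\<^bsub>mpoly_ring N\<^esub> a \<in> I" by simp
    qed (use assms in auto)
  qed (use assms in \<open>auto simp: mult.commute ring_axioms\<close>)
qed

lemma ideal_Idl_mpoly_ring:
  fixes S :: "'a::comm_ring_1 mpoly set"
  assumes "S \<subseteq> {p. mvars p \<subseteq> {..<N}}"
  shows "ideal (Idl\<^bsub>mpoly_ring N\<^esub> S) (mpoly_ring N)"
proof -
  interpret cring "mpoly_ring N :: 'a mpoly ring" by (rule cring_mpoly_ring)
  show ?thesis using assms by (intro genideal_ideal) auto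
qed

text \<open>The polynomials vanishing at a fixed point form an ideal, and an ideal containing the generators
  contains all they generate.\<close>

lemma complex_zeros_Idl:
  assumes "S \<subseteq> {p. mvars p \<subseteq> {..<N}}"
  shows "complex_zeros N (Idl\<^bsub>mpoly_ring N\<^esub> S) = {a \<in> carrier_vec N. \<forall>p\<in>S. complex_eval p a = 0}"
proof -
  interpret cring "mpoly_ring N :: real mpoly ring" by (rule cring_mpoly_ring)
  have S: "S \<subseteq> Idl\<^bsub>mpoly_ring N\<^esub> S" using assms by (intro genideal_self) auto
  have "complex_eval p a = 0" if a: "\<forall>p\<in>S. complex_eval p a = 0" and p: "p \<in> Idl\<^bsub>mpoly_ring N\<^esub> S" for p a
  proof -
    let ?J = "{p. mvars p \<subseteq> {..<N} \<and> complex_eval p a = 0}"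
    have "ideal ?J (mpoly_ring N)"
    proof (rule mpoly_ring_idealI)
      show "p + q \<in> ?J" if "p \<in> ?J" "q \<in> ?J" for p q
        using that mvars_add[of p q] by (auto simp: ce.hom_add)
      show "q * p \<in> ?J" if "p \<in> ?J" "mvars q \<subseteq> {..<N}" for p q
        using that mvars_mult[of q p] by (auto simp: ce.hom_mult)
    qed auto
    then have "Idl\<^bsub>mpoly_ring N\<^esub> S \<subseteq> ?J"
      using a assms by (intro genideal_minimal) auto
    then show ?thesis using p by auto
  qed
  then show ?thesis using S by (auto simp: complex_zeros_def)
qed

section \<open>Univariate polynomials in one of the variables\<close>

text \<open>\<open>in_y1\<close> is the case \<open>i = 0\<close>; other variables are needed for the product of \<open>y\<^sub>i - a\<^sub>i\<close> over
  the points of a variety, which bounds the degree in \<open>y\<^sub>i\<close>.\<close>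

definition in_var :: "nat \<Rightarrow> 'a::comm_ring_1 poly \<Rightarrow> 'a mpoly" where
  "in_var i p = poly (map_poly MConst p) (MVar i)"

lemma comm_ring_hom_in_var: "comm_ring_hom (in_var i :: 'a::comm_ring_1 poly \<Rightarrow> 'a mpoly)"
proof -
  interpret map_poly_comm_ring_hom "MConst :: 'a \<Rightarrow> 'a mpoly" ..
  show ?thesis
    by standard (simp_all add: in_var_def hom_add hom_mult)
qed

interpretation in_var: comm_ring_hom "in_var i :: 'a::comm_ring_1 poly \<Rightarrow> 'a mpoly"
  by (rule comm_ring_hom_in_var)

lemma in_var_const: "in_var i [:c:] = MConst c"
  by (simp add: in_var_def Polynomial.map_poly_pCons)

lemma in_var_smult: "in_var i (Polynomial.smult c p) = MConst c * in_var i p"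
  using in_var.hom_mult[of i "[:c:]" p] by (simp add: in_var_const)

lemma in_var_linear: "in_var i [:a, b:] = MConst a + MVar i * MConst b"
  by (simp add: in_var_def Polynomial.map_poly_pCons)

section \<open>A Nullstellensatz over the complex numbers\<close>

text \<open>Here the ring is the whole type of polynomials in countably many variables. Countably many monomials
  are all that the counting argument requires, and a fixed number of variables would only add side
  conditions.\<close>

definition ring_ideal :: "'a::comm_ring_1 set \<Rightarrow> bool" where
  "ring_ideal J \<longleftrightarrow> 0 \<in> J \<and> (\<forall>x\<in>J. \<forall>y\<in>J. x + y \<in> J) \<and> (\<forall>x\<in>J. \<forall>r. r * x \<in> J)"

lemma ring_idealD:
  assumes "ring_ideal J"
  shows "0 \<in> J" "x \<in> J \<Longrightarrow> y \<in> J \<Longrightarrow> x + y \<in> J" "x \<in> J \<Longrightarrow> r * x \<in> J"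
    "x \<in> J \<Longrightarrow> y \<in> J \<Longrightarrow> x - y \<in> J" "(\<And>i. i \<in> X \<Longrightarrow> f i \<in> J) \<Longrightarrow> sum f X \<in> J"
proof -
  show *: "0 \<in> J" "x \<in> J \<Longrightarrow> y \<in> J \<Longrightarrow> x + y \<in> J" "x \<in> J \<Longrightarrow> r * x \<in> J" for x y r
    using assms by (auto simp: ring_ideal_def)
  show "x \<in> J \<Longrightarrow> y \<in> J \<Longrightarrow> x - y \<in> J"
    using *(2)[of x "- y"] *(3)[of y "- 1"] by simp
  show "(\<And>i. i \<in> X \<Longrightarrow> f i \<in> J) \<Longrightarrow> sum f X \<in> J"
    by (induction X rule: infinite_finite_induct) (auto intro: *)
qed

text \<open>The powers of \<open>p\<close> are avoided, rather than just \<open>1\<close> as for a maximal ideal, so that \<open>p\<close> does not vanish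
  at the point found later. This yields the strong form of the Nullstellensatz directly, without
  adjoining an inverse of \<open>p\<close>.\<close>

lemma ideal_maximal_avoiding_powers:
  fixes I :: "'a::comm_ring_1 set"
  assumes "ring_ideal I" "\<And>k::nat. p ^ k \<notin> I"
  obtains J where "ring_ideal J" "I \<subseteq> J" "\<And>k::nat. p ^ k \<notin> J"
    "\<And>g. g \<notin> J \<Longrightarrow> \<exists>(k::nat) h. p ^ k - h * g \<in> J"
proof -
  define A where "A = {J. ring_ideal J \<and> I \<subseteq> J \<and> (\<forall>k::nat. p ^ k \<notin> J)}"
  have "\<exists>M\<in>A. \<forall>X\<in>A. M \<subseteq> X \<longrightarrow> X = M"
  proof (rule subset_Zorn_nonempty)
    show "A \<noteq> {}" using assms by (auto simp: A_def)
    fix C assume C: "C \<noteq> {}" "subset.chain A C"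
    have ideals: "ring_ideal X" if "X \<in> C" for X
      using that C by (auto simp: subset.chain_def A_def)
    have "ring_ideal (\<Union>C)"
      unfolding ring_ideal_def
    proof (intro conjI ballI allI)
      show "0 \<in> \<Union>C" using C ideals ring_idealD(1) by blast
    next
      fix x y assume "x \<in> \<Union>C" "y \<in> \<Union>C"
      then obtain X Y where XY: "X \<in> C" "Y \<in> C" "x \<in> X" "y \<in> Y" by auto
      with C have "X \<subseteq> Y \<or> Y \<subseteq> X"
        by (auto simp: subset.chain_def)
      then show "x + y \<in> \<Union>C"
        using XY ideals ring_idealD(2) by (metis UnionI subsetD)
    next
      fix x r assume "x \<in> \<Union>C"
      then show "r * x \<in> \<Union>C" using ideals ring_idealD(3) by blast
    qed
    moreover have "I \<subseteq> X \<and> (\<forall>k::nat. p ^ k \<notin> X)" if "X \<in> C" for X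
      using that C by (auto simp: subset.chain_def A_def)
    then have "I \<subseteq> \<Union>C" "\<forall>k::nat. p ^ k \<notin> \<Union>C"
      using C(1) by blast+
    ultimately show "\<Union>C \<in> A" by (simp add: A_def)
  qed
  then obtain J where J: "J \<in> A" and max: "\<And>X. X \<in> A \<Longrightarrow> J \<subseteq> X \<Longrightarrow> X = J" by blast
  have JI: "ring_ideal J" and "I \<subseteq> J" using J by (auto simp: A_def)
  note id = ring_idealD[OF JI]
  have "\<exists>(k::nat) h. p ^ k - h * g \<in> J" if g: "g \<notin> J" for g
  proof (rule ccontr)
    assume contr: "\<not> ?thesis"
    \<comment> \<open>The ideal generated by \<open>J\<close> and \<open>g\<close>, which would also avoid the powers of \<open>p\<close>.\<close>
    define X where "X = {x. \<exists>h. x - h * g \<in> J}"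
    have "ring_ideal X"
      unfolding ring_ideal_def X_def
    proof (intro conjI ballI allI)
      show "0 \<in> {x. \<exists>h. x - h * g \<in> J}"
        using id(1) by (auto intro!: exI[of _ 0])
    next
      fix x y assume "x \<in> {x. \<exists>h. x - h * g \<in> J}" "y \<in> {x. \<exists>h. x - h * g \<in> J}"
      then obtain h h' where "x - h * g \<in> J" "y - h' * g \<in> J" by blast
      from id(2)[OF this] show "x + y \<in> {x. \<exists>h. x - h * g \<in> J}"
        by (intro CollectI exI[of _ "h + h'"]) (simp add: algebra_simps)
    next
      fix x r assume "x \<in> {x. \<exists>h. x - h * g \<in> J}"
      then obtain h where "x - h * g \<in> J" by blast
      from id(3)[OF this, of r] show "r * x \<in> {x. \<exists>h. x - h * g \<in> J}"
        by (intro CollectI exI[of _ "r * h"]) (simp add: algebra_simps)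
    qed
    moreover have JX: "J \<subseteq> X"
      unfolding X_def by (auto intro!: exI[of _ 0])
    moreover have "\<forall>k::nat. p ^ k \<notin> X"
      using contr by (auto simp: X_def)
    ultimately have "X = J"
      using \<open>I \<subseteq> J\<close> by (intro max) (auto simp: A_def)
    moreover have "g \<in> X"
      unfolding X_def using id(1) by (auto intro!: exI[of _ 1])
    ultimately show False using g by simp
  qed
  then show ?thesis using J that by (auto simp: A_def)
qed

lemma ideal_maximal_avoiding_powers_prime:
  fixes J :: "'a::comm_ring_1 set"
  assumes "ring_ideal J" "\<And>k::nat. p ^ k \<notin> J" "\<And>g. g \<notin> J \<Longrightarrow> \<exists>(k::nat) h. p ^ k - h * g \<in> J"
    and ab: "a * b \<in> J"
  shows "a \<in> J \<or> b \<in> J"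
proof (rule ccontr)
  note id = ring_idealD[OF assms(1)]
  assume "\<not> (a \<in> J \<or> b \<in> J)"
  then obtain k l h h' where *: "p ^ k - h * a \<in> J" "p ^ l - h' * b \<in> J"
    using assms(3) by blast
  have "p ^ (k + l) = p ^ l * (p ^ k - h * a) + h * a * (p ^ l - h' * b) + h * h' * (a * b)"
    by (simp add: algebra_simps power_add)
  also have "\<dots> \<in> J"
    by (intro id(2) id(3) * ab)
  finally show False using assms(2) by blast
qed

lemma nontrivial_solution_of_wide_system:
  fixes M :: "'b \<Rightarrow> 'e \<Rightarrow> 'a::field"
  assumes "finite E" "finite B" "card E < card B"
  shows "\<exists>c. (\<exists>b\<in>B. c b \<noteq> 0) \<and> (\<forall>e\<in>E. (\<Sum>b\<in>B. c b * M b e) = 0)"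
  using assms
proof (induction E arbitrary: B M rule: finite_induct)
  case empty
  then have "B \<noteq> {}" by auto
  then show ?case by (intro exI[of _ "\<lambda>_. 1"]) auto
next
  case (insert e E)
  show ?case
  proof (cases "\<forall>b\<in>B. M b e = 0")
    case True
    have "card E < card B" using insert by simp
    from insert.IH[OF insert.prems(1) this, of M] obtain c
      where "\<exists>b\<in>B. c b \<noteq> 0" "\<forall>e\<in>E. (\<Sum>b\<in>B. c b * M b e) = 0" by blast
    with True show ?thesis by (intro exI[of _ c]) auto
  next
    case False
    then obtain b0 where b0: "b0 \<in> B" "M b0 e \<noteq> 0" by blast
    let ?B = "B - {b0}"
    let ?M = "\<lambda>b x. M b x - M b e / M b0 e * M b0 x"
    have "finite ?B" "card E < card ?B"
      using insert b0 by auto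
    from insert.IH[OF this, of ?M] obtain c where c: "\<exists>b\<in>?B. c b \<noteq> 0"
      and eq: "\<And>x. x \<in> E \<Longrightarrow> (\<Sum>b\<in>?B. c b * ?M b x) = 0" by blast
    define z where "z = - (\<Sum>b\<in>?B. c b * M b e) / M b0 e"
    define f where "f = c(b0 := z)"
    have sum: "(\<Sum>b\<in>B. f b * M b x) = z * M b0 x + (\<Sum>b\<in>?B. c b * M b x)" for x
      using insert.prems(1) b0 unfolding f_def by (subst sum.remove[of B b0]) auto
    have "(\<Sum>b\<in>B. f b * M b x) = 0" if "x \<in> insert e E" for x
    proof (cases "x = e")
      case True
      then show ?thesis unfolding sum z_def using b0 by simp
    next
      case False
      with that have "(\<Sum>b\<in>?B. c b * ?M b x) = 0" by (intro eq) auto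
      also have "(\<Sum>b\<in>?B. c b * ?M b x)
          = (\<Sum>b\<in>?B. c b * M b x) - (\<Sum>b\<in>?B. c b * M b e) / M b0 e * M b0 x"
        by (simp add: algebra_simps sum_subtractf sum_divide_distrib sum_distrib_left)
      finally show ?thesis unfolding sum z_def by (simp add: algebra_simps)
    qed
    moreover have "\<exists>b\<in>B. f b \<noteq> 0" using c by (auto simp: f_def)
    ultimately show ?thesis by blast
  qed
qed

text \<open>The polynomials whose monomials lie in \<open>mono_box d\<close> form a finite-dimensional space, and these
  spaces exhaust the polynomial ring as \<open>d\<close> grows.\<close>

definition mono_box :: "nat \<Rightarrow> (nat \<Rightarrow>\<^sub>0 nat) set" where
  "mono_box d = {m. Poly_Mapping.keys m \<subseteq> {..<d} \<and> (\<forall>i. Poly_Mapping.lookup m i \<le> d)}"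

lemma finite_mono_box: "finite (mono_box d)"
proof (rule finite_imageD)
  show "finite ((\<lambda>m. map (Poly_Mapping.lookup m) [0..<d]) ` mono_box d)"
    by (rule finite_subset[OF _ finite_lists_length_eq[of "{..d}" d]]) (auto simp: mono_box_def)
  show "inj_on (\<lambda>m. map (Poly_Mapping.lookup m) [0..<d]) (mono_box d)"
  proof (rule inj_onI, rule poly_mapping_eqI)
    fix m m' i assume m: "m \<in> mono_box d" "m' \<in> mono_box d"
      and eq: "map (Poly_Mapping.lookup m) [0..<d] = map (Poly_Mapping.lookup m') [0..<d]"
    show "Poly_Mapping.lookup m i = Poly_Mapping.lookup m' i"
    proof (cases "i < d")
      case True
      then show ?thesis using eq by simp
    next
      case False
      then have "i \<notin> Poly_Mapping.keys m" "i \<notin> Poly_Mapping.keys m'"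
        using m by (auto simp: mono_box_def)
      then show ?thesis by (simp add: in_keys_iff)
    qed
  qed
qed

lemma keys_subset_mono_box: "\<exists>d. Poly_Mapping.keys (p :: 'a::comm_ring_1 mpoly) \<subseteq> mono_box d"
proof -
  have single: "\<exists>d. \<forall>e\<ge>d. m \<in> mono_box e" for m :: "nat \<Rightarrow>\<^sub>0 nat"
  proof -
    let ?d = "Suc (Max (insert 0 (Poly_Mapping.keys m \<union> Poly_Mapping.lookup m ` Poly_Mapping.keys m)))"
    have "i < ?d" if "i \<in> Poly_Mapping.keys m" for i
      using that by (simp add: less_Suc_eq_le Max_ge_iff)
    moreover have "Poly_Mapping.lookup m i \<le> ?d" for i
    proof (cases "i \<in> Poly_Mapping.keys m")
      case True
      then have "Poly_Mapping.lookup m i \<le> Max (insert 0 (Poly_Mapping.keys m \<union> Poly_Mapping.lookup m ` Poly_Mapping.keys m))"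
        by (intro Max_ge) auto
      then show ?thesis by simp
    qed (simp add: in_keys_iff)
    ultimately show ?thesis
      by (intro exI[of _ ?d]) (auto simp: mono_box_def intro: order_trans less_le_trans)
  qed
  then obtain f where f: "\<And>m e. f m \<le> e \<Longrightarrow> m \<in> mono_box e" by metis
  have "m \<in> mono_box (Max (insert 0 (f ` Poly_Mapping.keys p)))" if "m \<in> Poly_Mapping.keys p" for m
    using that by (intro f Max_ge) auto
  then show ?thesis by blast
qed

lemma lookup_MConst_mult: "Poly_Mapping.lookup (MConst c * p) m = c * Poly_Mapping.lookup p m"
  unfolding MConst_def mult_map_scale_conv_mult[symmetric]
  by (simp add: Poly_Mapping.map.rep_eq when_def)

text \<open>Suppose that no \<open>x\<^sub>i - a\<close> lies in \<open>J\<close>. By maximality each of them divides a power \<open>p\<^sup>k\<close> modulo \<open>J\<close>,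
  with a cofactor \<open>h a\<close> that plays the role of \<open>p\<^sup>k / (x\<^sub>i - a)\<close>. Uncountably many \<open>a\<close> share only countably
  many exponents \<open>k\<close> and boxes of monomials, so arbitrarily many cofactors lie in one finite-dimensional space
  and satisfy a linear relation. Clearing denominators turns it into a nonzero univariate polynomial in
  \<open>x\<^sub>i\<close> that lies in the prime ideal \<open>J\<close>; over the complex numbers it splits into linear factors, one of
  which must lie in \<open>J\<close>.\<close>

lemma variable_constant_modulo_ideal:
  fixes J :: "complex mpoly set"
  assumes J: "ring_ideal J" and avoid: "\<And>k::nat. p ^ k \<notin> J"
    and max: "\<And>g. g \<notin> J \<Longrightarrow> \<exists>(k::nat) h. p ^ k - h * g \<in> J"
  shows "\<exists>a. MVar i - MConst a \<in> J"
proof (rule ccontr)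
  assume contr: "\<not> ?thesis"
  note id = ring_idealD[OF J]
  have prime: "a \<in> J \<or> b \<in> J" if "a * b \<in> J" for a b
    using ideal_maximal_avoiding_powers_prime[OF J avoid max that] .
  let ?L = "\<lambda>a. in_var i [:- a, 1:] :: complex mpoly"
  have L: "?L a \<notin> J" for a
    using contr by (simp add: in_var_linear MConst_hom.hom_uminus)
  \<comment> \<open>\<open>J\<close> is prime, so by splitting off roots no nonzero polynomial in \<open>x\<^sub>i\<close> can lie in \<open>J\<close>.\<close>
  have in_var_notin: "in_var i P \<notin> J" if "P \<noteq> 0" for P
    using that
  proof (induction "degree P" arbitrary: P)
    case 0
    then obtain c where P: "P = [:c:]" by (metis degree_eq_zeroE)
    with 0 have "c \<noteq> 0" by simp
    show ?case
    proof
      assume "in_var i P \<in> J"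
      then have "MConst (1 / c) * MConst c \<in> J" by (intro id(3)) (simp add: P in_var_const)
      then have "1 \<in> J" using \<open>c \<noteq> 0\<close> by (simp add: MConst_hom.hom_mult[symmetric])
      then show False using avoid[of 0] by simp
    qed
  next
    case (Suc d)
    then have "\<not> constant (poly P)" by (simp add: constant_degree)
    then obtain a where "poly P a = 0" using fundamental_theorem_of_algebra by blast
    then obtain Q where Q: "P = [:- a, 1:] * Q" by (auto simp: poly_eq_0_iff_dvd elim: dvdE)
    with Suc have "Q \<noteq> 0" by auto
    then have "d = degree Q" using Suc.hyps(2) unfolding Q by (subst (asm) degree_mult_eq) auto
    from Suc.hyps(1)[OF this \<open>Q \<noteq> 0\<close>] show ?case
      unfolding Q in_var.hom_mult using L prime by blast
  qed
  \<comment> \<open>Real values of \<open>a\<close> already form an uncountable set.\<close>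
  have "\<forall>a::real. \<exists>(k::nat) h. p ^ k - h * ?L (of_real a) \<in> J"
    using max L by blast
  then obtain k h where kh: "\<And>a::real. p ^ k a - h a * ?L (of_real a) \<in> J" by metis
  obtain d where d: "\<And>a. Poly_Mapping.keys (h a) \<subseteq> mono_box (d a)"
    using choice[of "\<lambda>a d. Poly_Mapping.keys (h a) \<subseteq> mono_box d"] keys_subset_mono_box by blast
  obtain K D where "infinite {a. k a = K \<and> d a = D}"
  proof (rule ccontr)
    assume "\<not> thesis"
    then have "countable {a. k a = K \<and> d a = D}" for K D
      using that by (blast intro: countable_finite)
    then have "countable (\<Union>x::nat \<times> nat. {a. k a = fst x \<and> d a = snd x})"
      by (intro countable_UN) auto
    moreover have "(\<Union>x::nat \<times> nat. {a. k a = fst x \<and> d a = snd x}) = UNIV"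
      by auto
    ultimately have "countable (UNIV :: real set)" by simp
    then show False using uncountable_UNIV_real by blast
  qed
  then obtain B where B: "finite B" "card B = Suc (card (mono_box D))"
    and BKD: "\<And>b. b \<in> B \<Longrightarrow> k b = K" "\<And>b. b \<in> B \<Longrightarrow> d b = D"
    by (auto dest!: infinite_arbitrarily_large[of _ "Suc (card (mono_box D))"])
  obtain c where c: "\<exists>b\<in>B. c b \<noteq> 0"
    and dep: "\<forall>m\<in>mono_box D. (\<Sum>b\<in>B. c b * Poly_Mapping.lookup (h b) m) = 0"
    using nontrivial_solution_of_wide_system[OF finite_mono_box B(1), of D "\<lambda>b. Poly_Mapping.lookup (h b)"] B(2)
    by auto
  have zero: "(\<Sum>b\<in>B. MConst (c b) * h b) = 0"
  proof (rule poly_mapping_eqI)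
    fix m
    have "(\<Sum>b\<in>B. c b * Poly_Mapping.lookup (h b) m) = 0"
    proof (cases "m \<in> mono_box D")
      case True
      then show ?thesis using dep by blast
    next
      case False
      then have "Poly_Mapping.lookup (h b) m = 0" if "b \<in> B" for b
        using d[of b] BKD(2)[OF that] by (auto simp: in_keys_iff subset_iff)
      then show ?thesis by simp
    qed
    then show "Poly_Mapping.lookup (\<Sum>b\<in>B. MConst (c b) * h b) m = Poly_Mapping.lookup 0 m"
      by (simp add: lookup_sum lookup_MConst_mult)
  qed
  let ?l = "\<lambda>b::real. [:- complex_of_real b, 1:]"
  \<comment> \<open>The numerator of \<open>\<Sum>\<^sub>b c\<^sub>b / (t - b)\<close>; it is nonzero at every \<open>b\<close> with \<open>c\<^sub>b \<noteq> 0\<close>.\<close>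
  define P where "P = (\<Sum>b\<in>B. [:c b:] * (\<Prod>b'\<in>B - {b}. ?l b'))"
  have "P \<noteq> 0"
  proof -
    obtain b0 where b0: "b0 \<in> B" "c b0 \<noteq> 0" using c by blast
    have "poly P (of_real b0) = (\<Sum>b\<in>B. c b * (\<Prod>b'\<in>B - {b}. of_real b0 - of_real b'))"
      by (simp add: P_def poly_sum poly_prod)
    also have "\<dots> = (\<Sum>b\<in>{b0}. c b * (\<Prod>b'\<in>B - {b}. of_real b0 - of_real b'))"
      using B(1) b0 by (intro sum.mono_neutral_right) auto
    also have "\<dots> \<noteq> 0" using b0 B(1) by auto
    finally show ?thesis by auto
  qed
  have "p ^ K * in_var i P = (\<Sum>b\<in>B. MConst (c b) * p ^ K * (\<Prod>b'\<in>B - {b}. in_var i (?l b')))"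
    by (simp add: P_def in_var.hom_sum in_var.hom_mult in_var.hom_prod in_var_smult sum_distrib_left mult_ac)
  \<comment> \<open>Subtracting a multiple of the linear relation exhibits the sum as a combination of the members
    \<open>p\<^sup>k - h b (x\<^sub>i - b)\<close> of \<open>J\<close>.\<close>
  also have "\<dots> = (\<Sum>b\<in>B. MConst (c b) * p ^ K * (\<Prod>b'\<in>B - {b}. in_var i (?l b')))
      - (\<Sum>b\<in>B. MConst (c b) * h b) * (\<Prod>b'\<in>B. in_var i (?l b'))"
    by (simp add: zero)
  also have "\<dots> = (\<Sum>b\<in>B. MConst (c b) * (\<Prod>b'\<in>B - {b}. in_var i (?l b')) * (p ^ k b - h b * in_var i (?l b)))"
    unfolding sum_distrib_right sum_subtractf[symmetric]
  proof (rule sum.cong[OF refl])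
    fix b assume b: "b \<in> B"
    then have "(\<Prod>b'\<in>B. in_var i (?l b')) = in_var i (?l b) * (\<Prod>b'\<in>B - {b}. in_var i (?l b'))"
      using B(1) by (rule prod.remove[rotated])
    then show "MConst (c b) * p ^ K * (\<Prod>b'\<in>B - {b}. in_var i (?l b'))
        - MConst (c b) * h b * (\<Prod>b'\<in>B. in_var i (?l b'))
        = MConst (c b) * (\<Prod>b'\<in>B - {b}. in_var i (?l b')) * (p ^ k b - h b * in_var i (?l b))"
      using BKD(1)[OF b] by (simp add: algebra_simps)
  qed
  also have "\<dots> \<in> J"
    by (intro id(5) id(3) kh)
  finally show False
    using prime avoid in_var_notin[OF \<open>P \<noteq> 0\<close>] by blast
qed

text \<open>Modulo an ideal \<open>J\<close> that contains \<open>I\<close> and is maximal among those avoiding the powers of \<open>p\<close>, every variable is a constant \<open>a i\<close>, so every polynomial is congruent to its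
  value at \<open>a\<close>. A nonzero value of a member of \<open>J\<close>, and likewise the value zero of \<open>p\<close>, would put a power
  of \<open>p\<close> into \<open>J\<close>.\<close>

theorem complex_nullstellensatz:
  fixes I :: "complex mpoly set"
  assumes "ring_ideal I" "\<And>k::nat. p ^ k \<notin> I"
  obtains a where "\<And>q. q \<in> I \<Longrightarrow> mpoly_eval (\<lambda>c. c) a q = 0" "mpoly_eval (\<lambda>c. c) a p \<noteq> 0"
proof -
  obtain J where J: "ring_ideal J" "I \<subseteq> J" and avoid: "\<And>k::nat. p ^ k \<notin> J"
    and max: "\<And>g. g \<notin> J \<Longrightarrow> \<exists>(k::nat) h. p ^ k - h * g \<in> J"
    using ideal_maximal_avoiding_powers[OF assms] by blast
  note id = ring_idealD[OF J(1)]
  obtain a where a: "\<And>i. MVar i - MConst (a i) \<in> J"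
    using variable_constant_modulo_ideal[OF J(1) avoid max] by metis
  let ?e = "mpoly_eval (\<lambda>c. c) a"
  interpret e: comm_ring_hom ?e
    by (intro comm_ring_hom_mpoly_eval comm_ring_hom_id)
  have mod: "q - MConst (?e q) \<in> J" for q
    using order_refl[of "mvars q"]
  proof (induction q rule: mpoly_induct)
    case (const c)
    show ?case using id(1) by (simp add: mpoly_eval_MConst)
  next
    case (var i)
    show ?case using a by (simp add: mpoly_eval_MVar)
  next
    case (add q r)
    have "(q + r) - MConst (?e (q + r)) = (q - MConst (?e q)) + (r - MConst (?e r))"
      by (simp add: e.hom_add MConst_hom.hom_add algebra_simps)
    also have "\<dots> \<in> J" using add by (intro id(2))
    finally show ?case .
  next
    case (mult q r)
    have "(q * r) - MConst (?e (q * r)) = r * (q - MConst (?e q)) + MConst (?e q) * (r - MConst (?e r))"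
      by (simp add: e.hom_mult MConst_hom.hom_mult algebra_simps)
    also have "\<dots> \<in> J" using mult by (intro id(2) id(3))
    finally show ?case .
  qed
  have "?e q = 0" if "q \<in> I" for q
  proof (rule ccontr)
    assume nz: "?e q \<noteq> 0"
    have "MConst (?e q) \<in> J"
      using id(4)[OF _ mod[of q], of q] that J(2) by auto
    from id(3)[OF this, of "MConst (1 / ?e q)"] have "1 \<in> J"
      using nz by (simp add: MConst_hom.hom_mult[symmetric])
    then show False using avoid[of 0] by simp
  qed
  moreover have "?e p \<noteq> 0"
    using mod[of p] avoid[of 1] by auto
  ultimately show ?thesis by (rule that)
qed

section \<open>Radicals of real ideals\<close>

definition complexify :: "real mpoly \<Rightarrow> complex mpoly" where
  "complexify = mpoly_eval (\<lambda>c. MConst (of_real c)) MVar"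

lemma comm_ring_hom_complexify: "comm_ring_hom complexify"
proof -
  have "comm_ring_hom (\<lambda>c. MConst (complex_of_real c))"
    by standard (auto simp: MConst_hom.hom_add MConst_hom.hom_mult)
  then show ?thesis
    unfolding complexify_def by (rule comm_ring_hom_mpoly_eval)
qed

interpretation complexify: comm_ring_hom complexify
  by (rule comm_ring_hom_complexify)

lemma complexify_MConst [simp]: "complexify (MConst c) = MConst (of_real c)"
  and complexify_MVar [simp]: "complexify (MVar i) = MVar i"
  by (simp_all add: complexify_def mpoly_eval_MConst mpoly_eval_MVar)

lemma lookup_complexify: "Poly_Mapping.lookup (complexify p) m = of_real (Poly_Mapping.lookup p m)"
  unfolding complexify_def mpoly_eval_def mono_eval_def[symmetric] mono_eval_MVar
  by (auto simp: MConst_def mult_single lookup_sum lookup_single when_def in_keys_iff sum.delta)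

lemma complexify_mult_expand:
  "(complexify u + MConst \<i> * complexify v) * (complexify u' + MConst \<i> * complexify v')
    = complexify (u * u' - v * v') + MConst \<i> * complexify (u * v' + v * u')"
proof -
  have i: "MConst \<i> * MConst \<i> = (- 1 :: complex mpoly)"
    by (simp add: MConst_hom.hom_mult[symmetric] MConst_hom.hom_uminus)
  have "(complexify u + MConst \<i> * complexify v) * (complexify u' + MConst \<i> * complexify v')
      = complexify u * complexify u' + (MConst \<i> * MConst \<i>) * complexify v * complexify v'
        + MConst \<i> * (complexify u * complexify v' + complexify v * complexify u')"
    by (simp add: algebra_simps)
  then show ?thesis
    by (simp add: i complexify.hom_add complexify.hom_mult complexify.hom_minus)
qed

lemma complexify_split_eq:
  assumes "complexify p = complexify u + MConst \<i> * complexify v"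
  shows "p = u"
proof (rule poly_mapping_eqI)
  fix m
  have "complex_of_real (Poly_Mapping.lookup p m)
      = of_real (Poly_Mapping.lookup u m) + \<i> * of_real (Poly_Mapping.lookup v m)"
    using arg_cong[OF assms, of "\<lambda>q. Poly_Mapping.lookup q m"]
    by (simp add: lookup_add lookup_MConst_mult lookup_complexify)
  from arg_cong[OF this, of Re] show "Poly_Mapping.lookup p m = Poly_Mapping.lookup u m"
    by simp
qed

text \<open>Complex polynomials have real and imaginary parts, which makes it possible to describe the extension
  of a real ideal to complex coefficients by pairs of its members.\<close>

lemma complexify_split:
  fixes P :: "complex mpoly"
  assumes "mvars P \<subseteq> A"
  shows "\<exists>u v. mvars u \<subseteq> A \<and> mvars v \<subseteq> A \<and> P = complexify u + MConst \<i> * complexify v"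
  using assms
proof (induction P rule: mpoly_induct)
  case (const c)
  have "MConst c = complexify (MConst (Re c)) + MConst \<i> * complexify (MConst (Im c))"
    by (simp add: MConst_hom.hom_add[symmetric] MConst_hom.hom_mult[symmetric] complex_eq[symmetric])
  then show ?case by (metis empty_subsetI mvars_MConst)
next
  case (var i)
  have "MVar i = complexify (MVar i) + MConst \<i> * complexify 0"
    by simp
  then show ?case using var by (metis empty_subsetI mvars_0 mvars_MVar insert_subset)
next
  case (add P Q)
  then obtain u v u' v' where *: "mvars u \<subseteq> A" "mvars v \<subseteq> A" "P = complexify u + MConst \<i> * complexify v"
    "mvars u' \<subseteq> A" "mvars v' \<subseteq> A" "Q = complexify u' + MConst \<i> * complexify v'" by blast
  then have "P + Q = complexify (u + u') + MConst \<i> * complexify (v + v')"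
    by (simp add: complexify.hom_add algebra_simps)
  then show ?case using * mvars_add[of u u'] mvars_add[of v v'] by (meson Un_least order_trans)
next
  case (mult P Q)
  then obtain u v u' v' where *: "mvars u \<subseteq> A" "mvars v \<subseteq> A" "P = complexify u + MConst \<i> * complexify v"
    "mvars u' \<subseteq> A" "mvars v' \<subseteq> A" "Q = complexify u' + MConst \<i> * complexify v'" by blast
  then have "P * Q = complexify (u * u' - v * v') + MConst \<i> * complexify (u * v' + v * u')"
    by (simp add: complexify_mult_expand)
  moreover have "mvars (u * u' - v * v') \<subseteq> A" "mvars (u * v' + v * u') \<subseteq> A"
    using * mvars_diff[of "u * u'" "v * v'"] mvars_add[of "u * v'" "v * u'"]
      mvars_mult[of u u'] mvars_mult[of v v'] mvars_mult[of u v'] mvars_mult[of v u'] by blast+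
  ultimately show ?case by blast
qed

text \<open>The complex Nullstellensatz is applied to the ideal of all polynomials that, after the variables of index
  at least \<open>N\<close> are set to zero, have real and imaginary part in \<open>I\<close>. If a power of the real polynomial
  \<open>p\<close> has this form, comparing real parts shows that the power itself lies in \<open>I\<close>.\<close>

theorem radical_eq_vanishing:
  assumes I: "ideal I (mpoly_ring N)"
  shows "radical N I = {p. mvars p \<subseteq> {..<N} \<and> (\<forall>a\<in>complex_zeros N I. complex_eval p a = 0)}"
proof (intro equalityI subsetI)
  fix p assume "p \<in> radical N I"
  then obtain k where k: "mvars p \<subseteq> {..<N}" "p ^ k \<in> I" by (auto simp: radical_def)
  have "complex_eval p a = 0" if "a \<in> complex_zeros N I" for a
  proof -
    have "complex_eval (p ^ k) a = 0" using that k(2) by (auto simp: complex_zeros_def)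
    then show ?thesis by (simp add: ce.hom_power)
  qed
  then show "p \<in> {p. mvars p \<subseteq> {..<N} \<and> (\<forall>a\<in>complex_zeros N I. complex_eval p a = 0)}"
    using k by simp
next
  note id = mpoly_ring_idealD[OF I]
  fix p assume "p \<in> {p. mvars p \<subseteq> {..<N} \<and> (\<forall>a\<in>complex_zeros N I. complex_eval p a = 0)}"
  then have p: "mvars p \<subseteq> {..<N}" and van: "\<And>a. a \<in> complex_zeros N I \<Longrightarrow> complex_eval p a = 0"
    by auto
  have uminus: "- q \<in> I" if "q \<in> I" for q
    using id(4)[OF that, of "- 1"] by simp
  define cut :: "complex mpoly \<Rightarrow> complex mpoly"
    where "cut = mpoly_eval MConst (\<lambda>j. if j < N then MVar j else 0)"
  interpret cut: comm_ring_hom cut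
    unfolding cut_def by (intro comm_ring_hom_mpoly_eval comm_ring_hom_MConst)
  have cut_vars: "mvars (cut P) \<subseteq> {..<N}" for P
    unfolding cut_def by (rule mvars_mpoly_eval) auto
  have cut_complexify: "cut (complexify q) = complexify q" if "mvars q \<subseteq> {..<N}" for q
    using that
    by (induction q rule: mpoly_induct)
      (auto simp: complexify.hom_add complexify.hom_mult cut.hom_add cut.hom_mult,
       auto simp: cut_def mpoly_eval_MConst mpoly_eval_MVar)
  define J where "J = {P. \<exists>u\<in>I. \<exists>v\<in>I. cut P = complexify u + MConst \<i> * complexify v}"
  have "ring_ideal J"
    unfolding ring_ideal_def
  proof (intro conjI ballI allI)
    show "0 \<in> J" unfolding J_def using id(2) by (auto intro!: bexI[of _ 0])
  next
    fix P Q assume "P \<in> J" "Q \<in> J"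
    then obtain u v u' v' where *: "u \<in> I" "v \<in> I" "cut P = complexify u + MConst \<i> * complexify v"
      "u' \<in> I" "v' \<in> I" "cut Q = complexify u' + MConst \<i> * complexify v'" by (auto simp: J_def)
    then have "cut (P + Q) = complexify (u + u') + MConst \<i> * complexify (v + v')"
      by (simp add: cut.hom_add complexify.hom_add algebra_simps)
    then show "P + Q \<in> J" unfolding J_def using * id(3) by blast
  next
    fix P Q assume "P \<in> J"
    then obtain u v where *: "u \<in> I" "v \<in> I" "cut P = complexify u + MConst \<i> * complexify v"
      by (auto simp: J_def)
    obtain s t where st: "mvars s \<subseteq> {..<N}" "mvars t \<subseteq> {..<N}" "cut Q = complexify s + MConst \<i> * complexify t"
      using complexify_split[OF cut_vars] by blast
    have "cut (Q * P) = complexify (s * u - t * v) + MConst \<i> * complexify (s * v + t * u)"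
      unfolding cut.hom_mult * st complexify_mult_expand ..
    moreover have "s * u - t * v \<in> I" "s * v + t * u \<in> I"
      using id(3)[OF id(4)[OF *(1) st(1)] uminus[OF id(4)[OF *(2) st(2)]]]
        id(3)[OF id(4)[OF *(2) st(1)] id(4)[OF *(1) st(2)]] by auto
    ultimately show "Q * P \<in> J" unfolding J_def by blast
  qed
  have "\<exists>k::nat. complexify p ^ k \<in> J"
  proof (rule ccontr)
    assume "\<not> ?thesis"
    then obtain a where a: "\<And>q. q \<in> J \<Longrightarrow> mpoly_eval (\<lambda>c. c) a q = 0"
      and ap: "mpoly_eval (\<lambda>c. c) a (complexify p) \<noteq> 0"
      using complex_nullstellensatz[OF \<open>ring_ideal J\<close>, of "complexify p"] by blast
    have ev: "mpoly_eval (\<lambda>c. c) a (complexify q) = complex_eval q (vec N a)" if "mvars q \<subseteq> {..<N}" for q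
    proof -
      have "mpoly_eval (\<lambda>c. c) a (complexify q) = mpoly_eval complex_of_real a q"
        unfolding complexify_def
        by (subst hom_mpoly_eval) (auto simp: mpoly_eval_MConst mpoly_eval_MVar
            intro: comm_ring_hom_mpoly_eval comm_ring_hom_id)
      also have "\<dots> = complex_eval q (vec N a)"
        unfolding complex_eval_def using that by (intro mpoly_eval_cong) auto
      finally show ?thesis .
    qed
    have "complexify q \<in> J" if "q \<in> I" for q
    proof -
      have "cut (complexify q) = complexify q + MConst \<i> * complexify 0"
        using that id(1) by (simp add: cut_complexify subset_iff)
      then show ?thesis unfolding J_def using that id(2) by blast
    qed
    then have "vec N a \<in> complex_zeros N I"
      using a ev id(1) by (fastforce simp: complex_zeros_def)
    with van ap ev[OF p] show False by auto
  qed
  then obtain k where "complexify (p ^ k) \<in> J" by (auto simp: complexify.hom_power)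
  moreover have "mvars (p ^ k) \<subseteq> {..<N}" using mvars_power p by blast
  ultimately obtain u v where "u \<in> I" "complexify (p ^ k) = complexify u + MConst \<i> * complexify v"
    unfolding J_def by (auto simp: cut_complexify)
  then have "p ^ k \<in> I" using complexify_split_eq by blast
  then have "p ^ Suc k \<in> I" using id(4)[OF _ p] by simp
  then show "p \<in> radical N I" using p by (auto simp: radical_def intro!: exI[of _ "Suc k"])
qed

section \<open>The lexicographic ordering\<close>

lemma lex_less_irrefl [simp]: "\<not> lex_less m m"
  by (auto simp: lex_less_def)

lemma lex_less_trans:
  assumes "lex_less a b" "lex_less b c"
  shows "lex_less a c"
proof -
  obtain k where k: "Poly_Mapping.lookup a k < Poly_Mapping.lookup b k"
    "\<And>j. j > k \<Longrightarrow> Poly_Mapping.lookup a j = Poly_Mapping.lookup b j"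
    using assms(1) by (auto simp: lex_less_def)
  obtain l where l: "Poly_Mapping.lookup b l < Poly_Mapping.lookup c l"
    "\<And>j. j > l \<Longrightarrow> Poly_Mapping.lookup b j = Poly_Mapping.lookup c j"
    using assms(2) by (auto simp: lex_less_def)
  have "Poly_Mapping.lookup a (max k l) < Poly_Mapping.lookup c (max k l)"
    using k l by (cases k l rule: linorder_cases) (auto simp: max_def)
  then show ?thesis
    unfolding lex_less_def using k(2) l(2) by (intro exI[of _ "max k l"]) auto
qed

lemma lex_less_total:
  assumes "m \<noteq> m'"
  shows "lex_less m m' \<or> lex_less m' m"
proof -
  let ?D = "{i. Poly_Mapping.lookup m i \<noteq> Poly_Mapping.lookup m' i}"
  have fin: "finite ?D"
    by (rule finite_subset[of _ "Poly_Mapping.keys m \<union> Poly_Mapping.keys m'"]) (auto simp: in_keys_iff)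
  have "?D \<noteq> {}"
    using assms poly_mapping_eqI[of m m'] by auto
  with fin have "Max ?D \<in> ?D" by (rule Max_in)
  moreover have "Poly_Mapping.lookup m j = Poly_Mapping.lookup m' j" if "j > Max ?D" for j
    using that Max_ge[OF fin, of j] by auto
  ultimately show ?thesis
    unfolding lex_less_def by (metis (mono_tags, lifting) mem_Collect_eq nat_neq_iff)
qed

lemma lex_less_asym: "lex_less m m' \<Longrightarrow> \<not> lex_less m' m"
  using lex_less_trans lex_less_irrefl by blast

lemma lex_less_add: "lex_less m m' \<Longrightarrow> lex_less (t + m) (t + m')"
  by (auto simp: lex_less_def lookup_add)

lemma mono_dvd_refl [simp]: "mono_dvd m m"
  and mono_dvd_trans: "mono_dvd a b \<Longrightarrow> mono_dvd b c \<Longrightarrow> mono_dvd a c"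
  by (auto simp: mono_dvd_def intro: order_trans)

lemma mono_dvd_antisym: "mono_dvd a b \<Longrightarrow> mono_dvd b a \<Longrightarrow> a = b"
  by (rule poly_mapping_eqI) (auto simp: mono_dvd_def intro: antisym)

lemma mono_dvd_lex_le:
  assumes "mono_dvd m m'"
  shows "m = m' \<or> lex_less m m'"
proof -
  have "\<not> lex_less m' m"
    using assms unfolding mono_dvd_def lex_less_def by (meson leD)
  then show ?thesis using lex_less_total by blast
qed

lemma mono_dvd_imp_add: "mono_dvd m m' \<Longrightarrow> (m' - m) + m = m'"
  by (rule poly_mapping_eqI) (auto simp: mono_dvd_def lookup_add lookup_minus)

text \<open>Reading exponents from the highest variable downwards turns this ordering into the lexicographic
  ordering of lists of a fixed length.\<close>

lemma wf_lex_less: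
  "wf {(m, m'). Poly_Mapping.keys m \<subseteq> {..<N} \<and> Poly_Mapping.keys m' \<subseteq> {..<N} \<and> lex_less m m'}"
proof -
  let ?f = "\<lambda>m. map (\<lambda>i. Poly_Mapping.lookup m (N - 1 - i)) [0..<N]"
  have "(?f m, ?f m') \<in> lexn less_than N"
    if sub: "Poly_Mapping.keys m \<subseteq> {..<N}" "Poly_Mapping.keys m' \<subseteq> {..<N}" and lex: "lex_less m m'" for m m'
  proof -
    obtain k where k: "Poly_Mapping.lookup m k < Poly_Mapping.lookup m' k"
      "\<And>j. j > k \<Longrightarrow> Poly_Mapping.lookup m j = Poly_Mapping.lookup m' j"
      using lex by (auto simp: lex_less_def)
    then have "k \<in> Poly_Mapping.keys m'" by (auto simp: in_keys_iff)
    then have "k < N" using sub by auto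
    let ?p = "N - 1 - k"
    have p: "?p < length (?f m)" "?p < length (?f m')" using \<open>k < N\<close> by auto
    have "take ?p (?f m) = take ?p (?f m')"
      using \<open>k < N\<close> by (intro nth_equalityI) (auto intro!: k(2))
    then have "?f m = take ?p (?f m) @ ?f m ! ?p # drop (Suc ?p) (?f m)"
      "?f m' = take ?p (?f m) @ ?f m' ! ?p # drop (Suc ?p) (?f m')"
      using id_take_nth_drop[OF p(1)] id_take_nth_drop[OF p(2)] by simp_all
    moreover have "(?f m ! ?p, ?f m' ! ?p) \<in> less_than"
      using \<open>k < N\<close> k(1) by simp
    ultimately show ?thesis
      unfolding lexn_conv by fastforce
  qed
  then have "{(m, m'). Poly_Mapping.keys m \<subseteq> {..<N} \<and> Poly_Mapping.keys m' \<subseteq> {..<N} \<and> lex_less m m'}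
      \<subseteq> inv_image (lexn less_than N) ?f"
    by (auto simp: inv_image_def)
  then show ?thesis
    by (rule wf_subset[OF wf_inv_image[OF wf_lexn[OF wf_less_than]]])
qed

lemma lead_mono_eqI:
  assumes "m \<in> Poly_Mapping.keys p" "\<And>m'. m' \<in> Poly_Mapping.keys p \<Longrightarrow> m' \<noteq> m \<Longrightarrow> lex_less m' m"
  shows "lead_mono p = m"
  unfolding lead_mono_def
proof (rule the_equality)
  show "m \<in> Poly_Mapping.keys p \<and> (\<forall>m'\<in>Poly_Mapping.keys p. m' \<noteq> m \<longrightarrow> lex_less m' m)"
    using assms by blast
  fix k assume k: "k \<in> Poly_Mapping.keys p \<and> (\<forall>m'\<in>Poly_Mapping.keys p. m' \<noteq> k \<longrightarrow> lex_less m' k)"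
  show "k = m"
  proof (rule ccontr)
    assume "k \<noteq> m"
    then have "lex_less k m" "lex_less m k" using assms k by auto
    then show False using lex_less_asym by blast
  qed
qed

lemma lead_mono_props:
  assumes "p \<noteq> 0"
  shows lead_mono_in_keys: "lead_mono p \<in> Poly_Mapping.keys p"
    and lead_mono_greatest: "\<And>m. m \<in> Poly_Mapping.keys p \<Longrightarrow> m \<noteq> lead_mono p \<Longrightarrow> lex_less m (lead_mono p)"
proof -
  have "\<exists>m\<in>S. \<forall>m'\<in>S. m' \<noteq> m \<longrightarrow> lex_less m' m" if "finite S" "S \<noteq> {}" for S
    using that
  proof (induction S rule: finite_ne_induct)
    case (insert x S)
    then obtain m where m: "m \<in> S" "\<forall>m'\<in>S. m' \<noteq> m \<longrightarrow> lex_less m' m" by blast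
    then show ?case
      using lex_less_total[of x m] lex_less_trans by (metis insert_iff)
  qed auto
  moreover have "Poly_Mapping.keys p \<noteq> {}"
    using assms by (metis empty_iff in_keys_iff lookup_zero poly_mapping_eqI)
  ultimately obtain m where m: "m \<in> Poly_Mapping.keys p"
    "\<And>m'. m' \<in> Poly_Mapping.keys p \<Longrightarrow> m' \<noteq> m \<Longrightarrow> lex_less m' m"
    using finite_keys by metis
  then have "lead_mono p = m" by (rule lead_mono_eqI)
  with m show "lead_mono p \<in> Poly_Mapping.keys p"
    "\<And>m. m \<in> Poly_Mapping.keys p \<Longrightarrow> m \<noteq> lead_mono p \<Longrightarrow> lex_less m (lead_mono p)" by auto
qed

lemma keys_subset_mvars: "m \<in> Poly_Mapping.keys p \<Longrightarrow> Poly_Mapping.keys m \<subseteq> mvars p"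
  by (auto simp: mvars_def)

lemma lookup_single_mult:
  "Poly_Mapping.lookup (Poly_Mapping.single t 1 * p) (t + m) = Poly_Mapping.lookup (p :: 'a::comm_ring_1 mpoly) m"
proof -
  have "Poly_Mapping.single t 1 * p = Poly_Mapping.single t 1 *
      (\<Sum>m\<in>Poly_Mapping.keys p. Poly_Mapping.single m (Poly_Mapping.lookup p m))"
    using arg_cong[OF mpoly_as_sum_of_terms[of p], of "\<lambda>q. Poly_Mapping.single t 1 * q"] .
  also have "\<dots> = (\<Sum>m\<in>Poly_Mapping.keys p. Poly_Mapping.single (t + m) (Poly_Mapping.lookup p m))"
    by (simp add: sum_distrib_left mult_single)
  finally have "Poly_Mapping.lookup (Poly_Mapping.single t 1 * p) (t + m)
      = (\<Sum>k\<in>Poly_Mapping.keys p. Poly_Mapping.lookup p k when k = m)"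
    by (simp only: lookup_sum lookup_single add_left_cancel)
  also have "\<dots> = Poly_Mapping.lookup p m"
    by (auto simp: when_def in_keys_iff)
  finally show ?thesis .
qed

lemma lead_mono_single_mult:
  fixes p :: "'a::comm_ring_1 mpoly"
  assumes "p \<noteq> 0"
  shows "lead_mono (Poly_Mapping.single t 1 * p) = t + lead_mono p"
    and "Poly_Mapping.single t 1 * p \<noteq> 0"
proof -
  have in_keys: "t + lead_mono p \<in> Poly_Mapping.keys (Poly_Mapping.single t 1 * p)"
    using lead_mono_in_keys[OF assms] by (simp add: in_keys_iff lookup_single_mult)
  then show "Poly_Mapping.single t 1 * p \<noteq> 0" by auto
  show "lead_mono (Poly_Mapping.single t 1 * p) = t + lead_mono p"
  proof (rule lead_mono_eqI[OF in_keys])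
    fix m' assume m': "m' \<in> Poly_Mapping.keys (Poly_Mapping.single t 1 * p)" "m' \<noteq> t + lead_mono p"
    then obtain m where "m' = t + m" "m \<in> Poly_Mapping.keys p"
      using keys_mult[of "Poly_Mapping.single t 1" p] by (auto split: if_splits)
    with m' show "lex_less m' (t + lead_mono p)"
      using lead_mono_greatest[OF assms, of m] lex_less_add by auto
  qed
qed

section \<open>Existence and uniqueness of reduced Groebner bases\<close>

lemma mvars_single: "mvars (Poly_Mapping.single m c) \<subseteq> Poly_Mapping.keys m"
  by (auto simp: mvars_def split: if_splits)

lemma lead_mono_mvars: "p \<noteq> 0 \<Longrightarrow> mvars p \<subseteq> A \<Longrightarrow> Poly_Mapping.keys (lead_mono p) \<subseteq> A"
  using keys_subset_mvars[OF lead_mono_in_keys] by blast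

lemma ideal_leads_upward_closed:
  fixes I :: "'a::comm_ring_1 mpoly set"
  assumes I: "ideal I (mpoly_ring N)" and m: "m \<in> lead_mono ` (I - {0})"
    and dvd: "mono_dvd m m'" and sub: "Poly_Mapping.keys m' \<subseteq> {..<N}"
  shows "m' \<in> lead_mono ` (I - {0})"
proof -
  obtain p where p: "p \<in> I" "p \<noteq> 0" "m = lead_mono p" using m by auto
  let ?t = "Poly_Mapping.single (m' - m) (1::'a)"
  have "Poly_Mapping.keys (m' - m) \<subseteq> Poly_Mapping.keys m'"
    by (auto simp: in_keys_iff lookup_minus)
  with sub have "mvars ?t \<subseteq> {..<N}" using mvars_single[of "m' - m" "1::'a"] by blast
  then have "?t * p \<in> I" using mpoly_ring_idealD(4)[OF I p(1)] by blast
  moreover have "lead_mono (?t * p) = m'" "?t * p \<noteq> 0"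
    using lead_mono_single_mult[OF p(2), of "m' - m"] mono_dvd_imp_add[OF dvd] p(3) by auto
  ultimately show ?thesis by (metis DiffI image_eqI singletonD)
qed

lemma ideal_monic_element:
  fixes I :: "'a::field mpoly set"
  assumes I: "ideal I (mpoly_ring N)" and m: "m \<in> lead_mono ` (I - {0})"
  obtains g where "g \<in> I" "Poly_Mapping.lookup g m = 1"
    "\<And>k. k \<in> Poly_Mapping.keys g \<Longrightarrow> k \<noteq> m \<Longrightarrow> lex_less k m"
proof -
  obtain p where p: "p \<in> I" "p \<noteq> 0" "m = lead_mono p" using m by auto
  let ?c = "Poly_Mapping.lookup p m"
  have c: "?c \<noteq> 0" using lead_mono_in_keys[OF p(2)] p(3) by (auto simp: in_keys_iff)
  show ?thesis
  proof (rule that[of "MConst (1 / ?c) * p"])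
    show "MConst (1 / ?c) * p \<in> I" by (rule mpoly_ring_idealD(4)[OF I p(1)]) simp
    show "Poly_Mapping.lookup (MConst (1 / ?c) * p) m = 1" using c by (simp add: lookup_MConst_mult)
    fix k assume "k \<in> Poly_Mapping.keys (MConst (1 / ?c) * p)" "k \<noteq> m"
    then show "lex_less k m"
      using lead_mono_greatest[OF p(2), of k] p(3) by (auto simp: in_keys_iff lookup_MConst_mult)
  qed
qed

text \<open>Division with remainder by the whole ideal: leading terms are removed either by subtracting a monic member
  of \<open>I\<close> or by moving them to the remainder \<open>r\<close>. The bound \<open>t\<close> is carried along because the remainder must
  stay below the leading monomial of a basis element.\<close>

lemma ideal_normal_form:
  fixes I :: "'a::field mpoly set"
  assumes I: "ideal I (mpoly_ring N)" and "Poly_Mapping.keys t \<subseteq> {..<N}" "mvars p \<subseteq> {..<N}"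
    and "\<And>m. m \<in> Poly_Mapping.keys p \<Longrightarrow> lex_less m t"
  shows "\<exists>r. mvars r \<subseteq> {..<N} \<and> p - r \<in> I \<and> Poly_Mapping.keys r \<inter> lead_mono ` (I - {0}) = {} \<and>
    (\<forall>m\<in>Poly_Mapping.keys r. lex_less m t)"
  using assms(2-)
proof (induction t arbitrary: p rule: wf_induct_rule[OF wf_lex_less[of N]])
  case (1 t)
  note id = mpoly_ring_idealD[OF I]
  let ?L = "lead_mono ` (I - {0})"
  show ?case
  proof (cases "p = 0")
    case True
    then show ?thesis using id(2) by (intro exI[of _ 0]) auto
  next
    case False
    define m where "m = lead_mono p"
    have m: "m \<in> Poly_Mapping.keys p" "\<And>k. k \<in> Poly_Mapping.keys p \<Longrightarrow> k \<noteq> m \<Longrightarrow> lex_less k m"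
      using lead_mono_props[OF False] by (auto simp: m_def)
    have mt: "lex_less m t" and mN: "Poly_Mapping.keys m \<subseteq> {..<N}"
      using m(1) 1(4) keys_subset_mvars[OF m(1)] 1(3) by auto
    let ?c = "Poly_Mapping.lookup p m"
    show ?thesis
    proof (cases "m \<in> ?L")
      case True
      obtain g where g: "g \<in> I" "Poly_Mapping.lookup g m = 1"
        "\<And>k. k \<in> Poly_Mapping.keys g \<Longrightarrow> k \<noteq> m \<Longrightarrow> lex_less k m"
        using ideal_monic_element[OF I True] by blast
      have cg: "MConst ?c * g \<in> I" by (rule id(4)[OF g(1)]) simp
      let ?p = "p - MConst ?c * g"
      have "mvars ?p \<subseteq> {..<N}"
        using mvars_diff[of p "MConst ?c * g"] 1(3) cg id(1) by blast
      moreover have "lex_less k m" if "k \<in> Poly_Mapping.keys ?p" for k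
      proof -
        have "k \<noteq> m" using that g(2) by (auto simp: in_keys_iff lookup_minus lookup_MConst_mult)
        moreover have "k \<in> Poly_Mapping.keys p \<or> k \<in> Poly_Mapping.keys g"
          using that by (auto simp: in_keys_iff lookup_minus lookup_MConst_mult)
        ultimately show ?thesis using m(2) g(3) by blast
      qed
      ultimately obtain r where r: "mvars r \<subseteq> {..<N}" "?p - r \<in> I" "Poly_Mapping.keys r \<inter> ?L = {}"
        "\<forall>k\<in>Poly_Mapping.keys r. lex_less k m"
        using 1(1)[of m ?p] mt mN 1(2) by auto
      have "p - r = (?p - r) + MConst ?c * g" by simp
      then have "p - r \<in> I" using id(3)[OF r(2) cg] by simp
      then show ?thesis using r mt lex_less_trans by blast
    next
      case False
      let ?s = "Poly_Mapping.single m ?c"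
      let ?p = "p - ?s"
      have sN: "mvars ?s \<subseteq> {..<N}" using mvars_single[of m ?c] mN by blast
      then have "mvars ?p \<subseteq> {..<N}"
        using mvars_diff[of p ?s] 1(3) by blast
      moreover have "lex_less k m" if "k \<in> Poly_Mapping.keys ?p" for k
        using that m(2)[of k] by (cases "k = m") (auto simp: in_keys_iff lookup_minus lookup_single when_def)
      ultimately obtain r where r: "mvars r \<subseteq> {..<N}" "?p - r \<in> I" "Poly_Mapping.keys r \<inter> ?L = {}"
        "\<forall>k\<in>Poly_Mapping.keys r. lex_less k m"
        using 1(1)[of m ?p] mt mN 1(2) by auto
      have "mvars (r + ?s) \<subseteq> {..<N}" using mvars_add[of r ?s] r(1) sN by blast
      moreover have "p - (r + ?s) \<in> I" using r(2) by (simp add: algebra_simps)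
      moreover have keys: "k = m \<or> k \<in> Poly_Mapping.keys r" if "k \<in> Poly_Mapping.keys (r + ?s)" for k
        using that keys_add[of r ?s] by (auto split: if_splits)
      ultimately show ?thesis
        using r(3,4) mt lex_less_trans False by (intro exI[of _ "r + ?s"]) blast
    qed
  qed
qed

text \<open>The basis has one element for each leading monomial that is minimal under divisibility: the monomial minus its
  normal form. The hypothesis \<open>zero_dim\<close> says that a power of each variable is a leading monomial; it bounds
  the exponents of minimal leading monomials, so there are finitely many.\<close>

lemma reduced_groebner_basis_exists:
  fixes I :: "'a::field mpoly set"
  assumes I: "ideal I (mpoly_ring N)"
    and zero_dim: "\<And>i. i < N \<Longrightarrow> \<exists>d. Poly_Mapping.single i d \<in> lead_mono ` (I - {0})"
  shows "\<exists>G. is_reduced_groebner_basis G I"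
proof -
  note id = mpoly_ring_idealD[OF I]
  define L where "L = lead_mono ` (I - {0})"
  define M where "M = {m \<in> L. \<forall>m'\<in>L. mono_dvd m' m \<longrightarrow> m' = m}"
  have LN: "Poly_Mapping.keys m \<subseteq> {..<N}" if "m \<in> L" for m
    using that id(1) lead_mono_mvars by (fastforce simp: L_def)
  have minimal: "\<exists>m0\<in>M. mono_dvd m0 m" if m: "m \<in> L" for m
  proof -
    define r where
      "r = {(m, m'). Poly_Mapping.keys m \<subseteq> {..<N} \<and> Poly_Mapping.keys m' \<subseteq> {..<N} \<and> lex_less m m'}"
    define Q where "Q = {k \<in> L. mono_dvd k m}"
    have "m \<in> Q" using m by (simp add: Q_def)
    then obtain m0 where "m0 \<in> Q" and min': "\<And>k. (k, m0) \<in> r \<Longrightarrow> k \<notin> Q"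
      using wf_lex_less[of N] unfolding r_def[symmetric] wf_eq_minimal by blast
    then have m0: "m0 \<in> L" "mono_dvd m0 m" by (auto simp: Q_def)
    have min: "\<not> (k \<in> L \<and> mono_dvd k m)" if "Poly_Mapping.keys k \<subseteq> {..<N}" "lex_less k m0" for k
      using min'[of k] that LN[OF m0(1)] by (auto simp: Q_def r_def)
    have "k = m0" if "k \<in> L" "mono_dvd k m0" for k
      using min[of k] LN that mono_dvd_trans[OF that(2) m0(2)] mono_dvd_lex_le[OF that(2)] by blast
    then have "m0 \<in> M" using m0 by (auto simp: M_def)
    with m0 show ?thesis by blast
  qed
  have "finite M"
  proof -
    obtain d where d: "\<And>i. i < N \<Longrightarrow> Poly_Mapping.single i (d i) \<in> L"
      using zero_dim unfolding L_def by metis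
    define D where "D = N + (\<Sum>i<N. d i)"
    have "M \<subseteq> mono_box D"
    proof
      fix m assume m: "m \<in> M"
      then have keys: "Poly_Mapping.keys m \<subseteq> {..<N}" using LN by (auto simp: M_def)
      have "Poly_Mapping.lookup m i \<le> D" for i
      proof (cases "i < N")
        case True
        have "Poly_Mapping.lookup m i \<le> d i"
        proof (rule ccontr)
          assume "\<not> ?thesis"
          then have "mono_dvd (Poly_Mapping.single i (d i)) m"
            by (auto simp: mono_dvd_def lookup_single when_def)
          then have "Poly_Mapping.single i (d i) = m" using m d[OF True] by (auto simp: M_def)
          then have "Poly_Mapping.lookup m i = d i" by auto
          with \<open>\<not> ?thesis\<close> show False by simp
        qed
        also have "d i \<le> (\<Sum>i<N. d i)" using True by (intro member_le_sum) auto
        finally show ?thesis by (simp add: D_def)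
      next
        case False
        then have "i \<notin> Poly_Mapping.keys m" using keys by auto
        then show ?thesis by (simp add: in_keys_iff)
      qed
      moreover have "Poly_Mapping.keys m \<subseteq> {..<D}" using keys by (auto simp: D_def)
      ultimately show "m \<in> mono_box D" by (auto simp: mono_box_def)
    qed
    then show ?thesis using finite_mono_box by (rule finite_subset)
  qed
  have "\<exists>g. g \<in> I \<and> Poly_Mapping.lookup g m = 1 \<and>
      (\<forall>k\<in>Poly_Mapping.keys g. k \<noteq> m \<longrightarrow> lex_less k m \<and> k \<notin> L)" if m: "m \<in> M" for m
  proof -
    have mL: "m \<in> L" using m by (simp add: M_def)
    obtain g where g: "g \<in> I" "Poly_Mapping.lookup g m = 1"
      "\<And>k. k \<in> Poly_Mapping.keys g \<Longrightarrow> k \<noteq> m \<Longrightarrow> lex_less k m"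
      using ideal_monic_element[OF I mL[unfolded L_def]] by blast
    let ?s = "Poly_Mapping.single m (1::'a)"
    let ?p = "g - ?s"
    have "mvars ?p \<subseteq> {..<N}"
      using mvars_diff[of g ?s] mvars_single[of m "1::'a"] LN[OF mL] id(1) g(1) by blast
    moreover have "lex_less k m" if "k \<in> Poly_Mapping.keys ?p" for k
      using that g(2,3) by (cases "k = m") (auto simp: in_keys_iff lookup_minus lookup_single when_def)
    ultimately obtain r where r: "mvars r \<subseteq> {..<N}" "?p - r \<in> I" "Poly_Mapping.keys r \<inter> L = {}"
        "\<forall>k\<in>Poly_Mapping.keys r. lex_less k m"
      using ideal_normal_form[OF I LN[OF mL], of ?p] unfolding L_def by blast
    have "- (?p - r) \<in> I" using id(4)[OF r(2), of "- 1"] by simp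
    from id(3)[OF g(1) this] have "r + ?s \<in> I" by (simp add: algebra_simps)
    moreover have "Poly_Mapping.lookup r m = 0"
      using r(4) lex_less_irrefl by (meson in_keys_iff)
    then have "Poly_Mapping.lookup (r + ?s) m = 1" by (simp add: lookup_add)
    moreover have "k \<in> Poly_Mapping.keys r" if "k \<in> Poly_Mapping.keys (r + ?s)" "k \<noteq> m" for k
      using that keys_add[of r ?s] by auto
    ultimately show ?thesis using r(3,4) by (intro exI[of _ "r + ?s"]) blast
  qed
  then obtain g where gI: "\<And>m. m \<in> M \<Longrightarrow> g m \<in> I" and g1: "\<And>m. m \<in> M \<Longrightarrow> Poly_Mapping.lookup (g m) m = 1"
    and glow: "\<And>m k. m \<in> M \<Longrightarrow> k \<in> Poly_Mapping.keys (g m) \<Longrightarrow> k \<noteq> m \<Longrightarrow> lex_less k m \<and> k \<notin> L"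
    by metis
  have lead: "lead_mono (g m) = m" if "m \<in> M" for m
    using that g1[OF that] glow by (intro lead_mono_eqI) (auto simp: in_keys_iff)
  have "is_reduced_groebner_basis (g ` M) I"
    unfolding is_reduced_groebner_basis_def is_groebner_basis_def
  proof (intro conjI ballI impI)
    show "finite (g ` M)" using \<open>finite M\<close> by simp
    show "g ` M \<subseteq> I" using gI by blast
    show "0 \<notin> g ` M" using g1 by (metis imageE lookup_zero zero_neq_one)
  next
    fix p assume "p \<in> I" "p \<noteq> 0"
    then have "lead_mono p \<in> L" by (auto simp: L_def)
    then show "\<exists>h\<in>g ` M. mono_dvd (lead_mono h) (lead_mono p)"
      using minimal lead by fastforce
  next
    fix h assume "h \<in> g ` M"
    then show "Poly_Mapping.lookup h (lead_mono h) = 1" using lead g1 by auto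
  next
    fix h h' k assume h: "h \<in> g ` M" "h' \<in> g ` M - {h}" and k: "k \<in> Poly_Mapping.keys h"
    obtain m m' where mm: "m \<in> M" "m' \<in> M" "h = g m" "h' = g m'" "m \<noteq> m'" using h by auto
    show "\<not> mono_dvd (lead_mono h') k"
    proof
      assume dvd: "mono_dvd (lead_mono h') k"
      then have dvd: "mono_dvd m' k" using mm lead by simp
      have m'L: "m' \<in> L" using mm by (simp add: M_def)
      show False
      proof (cases "k = m")
        case True
        then show ?thesis using dvd mm m'L by (auto simp: M_def)
      next
        case False
        then have "k \<notin> L" using glow[OF mm(1)] k mm(3) by blast
        moreover have "Poly_Mapping.keys k \<subseteq> {..<N}"
          using keys_subset_mvars[OF k] gI[OF mm(1)] id(1) mm(3) by blast
        ultimately show ?thesis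
          using ideal_leads_upward_closed[OF I _ dvd] m'L unfolding L_def by blast
      qed
    qed
  qed
  then show ?thesis by blast
qed

text \<open>Divisibility back and forth pairs each \<open>g\<close> with an element \<open>g'\<close> of the other basis that has the same leading
  monomial. The leading terms cancel in \<open>g - g'\<close>, so the leading monomial of a nonzero difference would be a lower
  monomial of \<open>g\<close> or \<open>g'\<close> that is divisible by some leading monomial, against reducedness.\<close>

lemma reduced_groebner_basis_subset:
  fixes I :: "'a::comm_ring_1 mpoly set"
  assumes I: "ideal I (mpoly_ring N)"
    and G: "is_reduced_groebner_basis G I" and G': "is_reduced_groebner_basis G' I"
  shows "G \<subseteq> G'"
proof
  note id = mpoly_ring_idealD[OF I]
  have nz: "h \<noteq> 0" "h \<in> I" if "is_reduced_groebner_basis H I" "h \<in> H" for h and H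
    using that by (auto simp: is_reduced_groebner_basis_def is_groebner_basis_def)
  have divisor: "\<exists>h\<in>H. mono_dvd (lead_mono h) (lead_mono p)"
    if "is_reduced_groebner_basis H I" "p \<in> I" "p \<noteq> 0" for H p
    using that by (auto simp: is_reduced_groebner_basis_def is_groebner_basis_def)
  have red: "\<not> mono_dvd (lead_mono h) m"
    if "is_reduced_groebner_basis H I" "g \<in> H" "h \<in> H" "h \<noteq> g" "m \<in> Poly_Mapping.keys g" for H g h m
    using that by (auto simp: is_reduced_groebner_basis_def)
  fix g assume g: "g \<in> G"
  obtain g' where g': "g' \<in> G'" "mono_dvd (lead_mono g') (lead_mono g)"
    using divisor[OF G' nz(2)[OF G g] nz(1)[OF G g]] by blast
  obtain h where h: "h \<in> G" "mono_dvd (lead_mono h) (lead_mono g')"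
    using divisor[OF G nz(2)[OF G' g'(1)] nz(1)[OF G' g'(1)]] by blast
  have "h = g"
    using red[OF G g h(1) _ lead_mono_in_keys[OF nz(1)[OF G g]]] mono_dvd_trans[OF h(2) g'(2)] by blast
  then have lead: "lead_mono g' = lead_mono g"
    using h(2) g'(2) mono_dvd_antisym by blast
  have "g - g' = 0"
  proof (rule ccontr)
    assume d: "g - g' \<noteq> 0"
    let ?m = "lead_mono (g - g')"
    have "- g' \<in> I" using id(4)[OF nz(2)[OF G' g'(1)], of "- 1"] by simp
    then have dI: "g - g' \<in> I" using id(3)[OF nz(2)[OF G g]] by fastforce
    have "Poly_Mapping.lookup g (lead_mono g) = 1" "Poly_Mapping.lookup g' (lead_mono g') = 1"
      using G G' g g'(1) by (simp_all add: is_reduced_groebner_basis_def)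
    then have "Poly_Mapping.lookup (g - g') (lead_mono g) = 0"
      by (simp add: lookup_minus lead)
    moreover have m: "?m \<in> Poly_Mapping.keys (g - g')" using lead_mono_in_keys[OF d] .
    ultimately have neq: "?m \<noteq> lead_mono g" by (auto simp: in_keys_iff)
    have contra: False
      if H: "is_reduced_groebner_basis H I" "q \<in> H" "lead_mono q = lead_mono g" "?m \<in> Poly_Mapping.keys q" for H q
    proof -
      obtain h where h: "h \<in> H" "mono_dvd (lead_mono h) ?m" using divisor[OF H(1) dI d] by blast
      then have "h = q" using red[OF H(1,2) h(1) _ H(4)] by blast
      moreover have "lex_less ?m (lead_mono q)"
        using lead_mono_greatest[OF nz(1)[OF H(1,2)] H(4)] neq H(3) by simp
      ultimately show False
        using mono_dvd_lex_le[OF h(2)] lex_less_asym by fastforce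
    qed
    have "?m \<in> Poly_Mapping.keys g \<or> ?m \<in> Poly_Mapping.keys g'"
      using m by (auto simp: in_keys_iff lookup_minus)
    then show False
      using contra[OF G g refl] contra[OF G' g'(1) lead] by blast
  qed
  then show "g \<in> G'" using g'(1) by simp
qed

lemma reduced_groebner_basis_eqI:
  fixes I :: "'a::field mpoly set"
  assumes "ideal I (mpoly_ring N)" "is_reduced_groebner_basis G I"
  shows "reduced_groebner_basis I = G"
  unfolding reduced_groebner_basis_def
  using assms reduced_groebner_basis_subset by (intro the_equality) blast+

section \<open>Univariate polynomials: leading monomials, conjugation, interpolation\<close>

lemma in_var_as_sum:
  "in_var i p = (\<Sum>k\<le>degree p. Poly_Mapping.single (Poly_Mapping.single i k) (coeff p k))"
proof -
  have deg: "degree (map_poly MConst p) = degree p"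
    by (rule degree_map_poly) simp
  show ?thesis
    unfolding in_var_def poly_altdef deg
    by (simp add: coeff_map_poly MVar_power MConst_def mult_single)
qed

lemma lookup_in_var: "Poly_Mapping.lookup (in_var i p) (Poly_Mapping.single i k) = coeff p k"
proof -
  have "(Poly_Mapping.single i k' = Poly_Mapping.single i k) = (k' = k)" for k' :: nat
    by (metis lookup_single_eq)
  then have "Poly_Mapping.lookup (in_var i p) (Poly_Mapping.single i k)
      = (\<Sum>k'\<le>degree p. if k' = k then coeff p k' else 0)"
    by (simp add: in_var_as_sum lookup_sum lookup_single when_def)
  also have "\<dots> = coeff p k"
    by (simp add: coeff_eq_0)
  finally show ?thesis .
qed

lemma keys_in_var:
  assumes "m \<in> Poly_Mapping.keys (in_var i p)"
  obtains k where "m = Poly_Mapping.single i k" "k \<le> degree p"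
proof -
  have "\<exists>k\<le>degree p. m = Poly_Mapping.single i k"
  proof (rule ccontr)
    assume "\<not> ?thesis"
    then have "Poly_Mapping.lookup (in_var i p) m = 0"
      by (auto simp: in_var_as_sum lookup_sum lookup_single when_def intro!: sum.neutral)
    with assms show False by (simp add: in_keys_iff)
  qed
  then show ?thesis using that by blast
qed

lemma in_var_eq_iff [simp]: "in_var i p = in_var i q \<longleftrightarrow> p = q"
  by (metis lookup_in_var poly_eqI)

lemma in_var_eq_0_iff [simp]: "in_var i p = 0 \<longleftrightarrow> p = 0"
  using in_var_eq_iff[of i p 0] by (simp del: in_var_eq_iff)

lemma mvars_in_var: "mvars (in_var i p) \<subseteq> {i}"
  by (auto simp: mvars_def elim!: keys_in_var split: if_splits)

lemma lex_less_single: "k < k' \<Longrightarrow> lex_less (Poly_Mapping.single i k) (Poly_Mapping.single i k')"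
  unfolding lex_less_def by (intro exI[of _ i]) (auto simp: lookup_single when_def)

lemma lead_mono_in_var:
  assumes "p \<noteq> 0"
  shows "lead_mono (in_var i p) = Poly_Mapping.single i (degree p)"
proof (rule lead_mono_eqI)
  show "Poly_Mapping.single i (degree p) \<in> Poly_Mapping.keys (in_var i p)"
    using assms by (simp add: in_keys_iff lookup_in_var)
  fix m assume "m \<in> Poly_Mapping.keys (in_var i p)" "m \<noteq> Poly_Mapping.single i (degree p)"
  then show "lex_less m (Poly_Mapping.single i (degree p))"
    by (metis keys_in_var le_neq_implies_less lex_less_single)
qed

lemma univariate_as_in_var:
  assumes "mvars p \<subseteq> {i}"
  obtains q where "p = in_var i q"
proof -
  have "\<exists>q. p = in_var i q"
    using assms
  proof (induction p rule: mpoly_induct)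
    case (const c)
    show ?case by (metis in_var_const)
  next
    case (var j)
    have "MVar i = in_var i [:0, 1:]" by (simp add: in_var_linear)
    with var show ?case by blast
  next
    case (add p q)
    then show ?case by (metis in_var.hom_add)
  next
    case (mult p q)
    then show ?case by (metis in_var.hom_mult)
  qed
  then show ?thesis using that by blast
qed

lemma complex_eval_in_var: "complex_eval (in_var i p) a = poly (map_poly of_real p) (a $ i)"
proof -
  have "complex_eval (in_var i p) a
      = poly (map_poly (\<lambda>q. complex_eval q a) (map_poly MConst p)) (complex_eval (MVar i) a)"
    unfolding in_var_def by (rule comm_semiring_hom.poly_map_poly[OF ce.comm_semiring_hom_axioms, symmetric])
  also have "map_poly (\<lambda>q. complex_eval q a) (map_poly MConst p) = map_poly of_real p"
    by (simp add: map_poly_map_poly comp_def)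
  finally show ?thesis by simp
qed

lemma poly_of_real: "poly (map_poly complex_of_real p) (of_real t) = of_real (poly p t)"
  by (induction p) (auto simp: Polynomial.map_poly_pCons)

lemma real_coefficients:
  assumes "map_poly cnj P = P"
  shows "map_poly of_real (map_poly Re P) = P"
proof (rule poly_eqI)
  fix k
  have "cnj (coeff P k) = coeff P k"
    using arg_cong[OF assms, of "\<lambda>P. coeff P k"] by (simp add: coeff_map_poly)
  then show "coeff (map_poly complex_of_real (map_poly Re P)) k = coeff P k"
    by (simp add: coeff_map_poly complex_eq_iff)
qed

lemma degree_linear_prod: "finite S \<Longrightarrow> degree (\<Prod>x\<in>S. [:- x, 1:] :: 'a::field poly) = card S"
  by (subst degree_prod_eq_sum_degree) auto

lemma real_poly_with_roots:
  assumes "finite S" "cnj ` S = S"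
  obtains w where "map_poly of_real w = (\<Prod>x\<in>S. [:- x, 1:])" "degree w = card S" "lead_coeff w = 1"
proof -
  let ?P = "\<Prod>x\<in>S. [:- x, 1:]"
  have cnj: "comm_ring_hom cnj" by standard auto
  have inj: "inj_on cnj S" by (simp add: inj_on_def)
  interpret cnj: comm_ring_hom cnj by (rule cnj)
  interpret map_poly_comm_ring_hom cnj ..
  have "map_poly cnj ?P = (\<Prod>x\<in>S. [:- cnj x, 1:])"
    by (simp add: hom_prod Polynomial.map_poly_pCons)
  also have "\<dots> = (\<Prod>x\<in>cnj ` S. [:- x, 1:])"
    by (simp add: prod.reindex[OF inj])
  finally have eq: "map_poly of_real (map_poly Re ?P) = ?P"
    using assms by (intro real_coefficients) simp
  let ?w = "map_poly Re ?P"
  have deg: "degree ?w = card S"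
    using degree_map_poly[of complex_of_real ?w] eq degree_linear_prod[OF assms(1)] by simp
  have "complex_of_real (coeff ?w (degree ?w)) = lead_coeff ?P"
    using arg_cong[OF eq, of "\<lambda>P. coeff P (card S)"] deg degree_linear_prod[OF assms(1)]
    by (simp add: coeff_map_poly)
  also have "\<dots> = 1" by (simp add: lead_coeff_prod)
  finally have "lead_coeff ?w = 1" by simp
  with eq deg that show ?thesis by blast
qed

lemma poly_linear_prod_eq_0_iff:
  "finite S \<Longrightarrow> poly (\<Prod>x\<in>S. [:- x, 1:]) t = 0 \<longleftrightarrow> t \<in> (S :: 'a::field set)"
  by (auto simp: poly_prod)

lemma interpolation_poly_exists:
  fixes b :: "'a::field \<Rightarrow> 'a"
  assumes "finite S"
  shows "\<exists>P. (P = 0 \<or> degree P < card S) \<and> (\<forall>x\<in>S. poly P x = b x)"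
  using assms
proof (induction S rule: finite_induct)
  case (insert y S)
  then obtain P where P: "P = 0 \<or> degree P < card S" "\<forall>x\<in>S. poly P x = b x" by blast
  let ?L = "\<Prod>x\<in>S. [:- x, 1:]"
  let ?c = "(b y - poly P y) / poly ?L y"
  let ?Q = "P + Polynomial.smult ?c ?L"
  have "poly ?L y \<noteq> 0" using insert by (simp add: poly_linear_prod_eq_0_iff)
  then have "\<forall>x\<in>insert y S. poly ?Q x = b x"
    using P(2) insert.hyps by (auto simp: poly_linear_prod_eq_0_iff)
  moreover have "degree ?Q \<le> card S"
    using P(1) degree_linear_prod[OF insert.hyps(1)]
    by (intro degree_add_le) (auto intro: order_trans[OF degree_smult_le])
  ultimately show ?case
    using insert.hyps by (intro exI[of _ ?Q]) auto
qed auto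

text \<open>Conjugating the coefficients of a complex interpolation polynomial gives another one for the same
  data, so the polynomial of the real parts of the coefficients, as the mean of the two, interpolates as well.\<close>

lemma real_interpolation_poly:
  assumes S: "finite S" "S \<noteq> {}" "cnj ` S = S" and b: "\<And>x. x \<in> S \<Longrightarrow> b (cnj x) = cnj (b x)"
  obtains u where "degree u < card S" "\<And>x. x \<in> S \<Longrightarrow> poly (map_poly complex_of_real u) x = b x"
proof -
  obtain P where P: "P = 0 \<or> degree P < card S" "\<And>x. x \<in> S \<Longrightarrow> poly P x = b x"
    using interpolation_poly_exists[OF S(1)] by blast
  have card: "card S > 0" using S by (simp add: card_gt_0_iff)
  let ?u = "map_poly Re P"
  have "degree ?u \<le> degree P"
    by (rule degree_le) (auto simp: coeff_map_poly coeff_eq_0)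
  then have "degree ?u < card S" using P(1) card by auto
  moreover have "poly (map_poly complex_of_real ?u) x = b x" if x: "x \<in> S" for x
  proof -
    have "x \<in> cnj ` S" using x S(3) by simp
    then obtain y where y: "y \<in> S" "x = cnj y" by blast
    have "poly (map_poly cnj P) x = b x"
      using poly_cnj[of P y] P(2)[OF y(1)] b[OF y(1)] y(2) by simp
    moreover have "map_poly complex_of_real ?u = Polynomial.smult (1/2) (P + map_poly cnj P)"
      by (rule poly_eqI) (simp add: coeff_map_poly complex_eq_iff)
    ultimately show ?thesis using P(2)[OF x] by simp
  qed
  ultimately show ?thesis by (rule that)
qed

section \<open>The shape lemma\<close>

definition vanishing_ideal :: "nat \<Rightarrow> complex vec set \<Rightarrow> real mpoly set" where
  "vanishing_ideal N V = {p. mvars p \<subseteq> {..<N} \<and> (\<forall>a\<in>V. complex_eval p a = 0)}"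

lemma ideal_vanishing_ideal: "ideal (vanishing_ideal N V) (mpoly_ring N)"
proof (rule mpoly_ring_idealI)
  show "p + q \<in> vanishing_ideal N V" if "p \<in> vanishing_ideal N V" "q \<in> vanishing_ideal N V" for p q
    using that mvars_add[of p q] by (auto simp: vanishing_ideal_def ce.hom_add)
  show "q * p \<in> vanishing_ideal N V" if "p \<in> vanishing_ideal N V" "mvars q \<subseteq> {..<N}" for p q
    using that mvars_mult[of q p] by (auto simp: vanishing_ideal_def ce.hom_mult)
qed (auto simp: vanishing_ideal_def)

lemma cnj_coordinates:
  assumes "V \<subseteq> carrier_vec N" "map_vec cnj ` V \<subseteq> V" "i < N"
  shows "cnj ` (\<lambda>a. a $ i) ` V = (\<lambda>a. a $ i) ` V"
proof -
  have *: "cnj x \<in> (\<lambda>a. a $ i) ` V" if x: "x \<in> (\<lambda>a. a $ i) ` V" for x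
  proof -
    obtain a where a: "a \<in> V" "x = a $ i" using x by auto
    then have "map_vec cnj a \<in> V" "map_vec cnj a $ i = cnj x" using assms by auto
    then show ?thesis by force
  qed
  show ?thesis
  proof (intro equalityI subsetI)
    fix x assume "x \<in> (\<lambda>a. a $ i) ` V"
    from imageI[OF *[OF this], of cnj] show "x \<in> cnj ` (\<lambda>a. a $ i) ` V" by simp
  qed (use * in auto)
qed

text \<open>For each \<open>i\<close> the real polynomial whose roots are the \<open>i\<close>-th coordinates of the points vanishes on \<open>V\<close>,
  and its leading monomial is a power of the variable \<open>i\<close>.\<close>

lemma vanishing_ideal_reduced_groebner_basis_exists:
  assumes V: "finite V" "V \<subseteq> carrier_vec N" "map_vec cnj ` V \<subseteq> V"
  shows "\<exists>G. is_reduced_groebner_basis G (vanishing_ideal N V)"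
proof (rule reduced_groebner_basis_exists[OF ideal_vanishing_ideal])
  fix i assume i: "i < N"
  let ?S = "(\<lambda>a. a $ i) ` V"
  have fin: "finite ?S" using V by simp
  obtain w where w: "map_poly of_real w = (\<Prod>x\<in>?S. [:- x, 1:])" "lead_coeff w = 1"
    using real_poly_with_roots[OF fin cnj_coordinates[OF V(2,3) i]] by blast
  have "complex_eval (in_var i w) a = 0" if "a \<in> V" for a
    unfolding complex_eval_in_var w(1) poly_linear_prod_eq_0_iff[OF fin] using that by blast
  then have "in_var i w \<in> vanishing_ideal N V"
    using mvars_in_var[of i w] i by (auto simp: vanishing_ideal_def)
  moreover have "w \<noteq> 0" using w(2) by auto
  ultimately show "\<exists>d. Poly_Mapping.single i d \<in> lead_mono ` (vanishing_ideal N V - {0})"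
    using lead_mono_in_var[of w i] by (metis DiffI image_eqI in_var_eq_0_iff singletonD)
qed

lemma lookup_in_var_other:
  assumes "i \<noteq> j"
  shows "Poly_Mapping.lookup (in_var i u) (Poly_Mapping.single j (1::nat)) = 0"
proof (rule ccontr)
  assume "\<not> ?thesis"
  then have "Poly_Mapping.single j 1 \<in> Poly_Mapping.keys (in_var i u)"
    by (simp add: in_keys_iff)
  then obtain k where "Poly_Mapping.single j (1::nat) = Poly_Mapping.single i k"
    by (rule keys_in_var)
  from arg_cong[OF this, of "\<lambda>m. Poly_Mapping.lookup m j"] show False
    using assms by (simp add: lookup_single)
qed

lemma lookup_var_minus:
  assumes "j \<noteq> 0"
  shows "Poly_Mapping.lookup (MVar i - in_var 0 u :: 'a::comm_ring_1 mpoly) (Poly_Mapping.single j 1)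
    = (if i = j then 1 else 0)"
proof -
  have "(Poly_Mapping.single i (1::nat) = Poly_Mapping.single j 1) = (i = j)"
    by (metis lookup_single_eq lookup_single_not_eq zero_neq_one)
  then show ?thesis
    using lookup_in_var_other[of 0 j u] assms by (simp add: lookup_minus MVar_def lookup_single when_def)
qed

lemma keys_var_minus:
  assumes "m \<in> Poly_Mapping.keys (MVar i - in_var 0 u :: 'a::comm_ring_1 mpoly)" "m \<noteq> Poly_Mapping.single i 1"
  obtains k where "m = Poly_Mapping.single 0 k" "k \<le> degree u"
proof -
  have "Poly_Mapping.lookup (MVar i) m = (0 :: 'a)"
    using assms(2) by (simp add: MVar_def lookup_single when_def)
  then have "m \<in> Poly_Mapping.keys (in_var 0 u)"
    using assms(1) by (simp add: in_keys_iff lookup_minus)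
  then show ?thesis using that by (rule keys_in_var)
qed

lemma lead_mono_var_minus:
  assumes "i \<noteq> 0"
  shows "lead_mono (MVar i - in_var 0 u :: 'a::comm_ring_1 mpoly) = Poly_Mapping.single i 1"
proof (rule lead_mono_eqI)
  show "Poly_Mapping.single i 1 \<in> Poly_Mapping.keys (MVar i - in_var 0 u :: 'a mpoly)"
    using lookup_var_minus[OF assms, of i u] by (simp add: in_keys_iff)
  fix m assume "m \<in> Poly_Mapping.keys (MVar i - in_var 0 u :: 'a mpoly)" "m \<noteq> Poly_Mapping.single i 1"
  then obtain k where "m = Poly_Mapping.single 0 k" by (rule keys_var_minus)
  then show "lex_less m (Poly_Mapping.single i 1)"
    using assms unfolding lex_less_def by (intro exI[of _ i]) (auto simp: lookup_single when_def)
qed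

lemma in_y1_eq_in_var: "in_y1 p = in_var 0 p"
  by (simp add: in_y1_def in_var_def)

lemma in_var_neq_var_minus: "i \<noteq> 0 \<Longrightarrow> in_var 0 w \<noteq> (MVar i - in_var 0 u :: 'a::comm_ring_1 mpoly)"
  using lookup_in_var_other[of 0 i w] lookup_var_minus[of i i u] by force

text \<open>Only \<open>y\<^sub>j - u\<^sub>j\<close> contains the monomial \<open>y\<^sub>j\<close>, so the elements of the set can be told apart.\<close>

lemma has_shape_unique:
  assumes "has_shape N G (w, us)" "has_shape N G (w', us')"
  shows "w = w' \<and> us = us'"
proof -
  let ?v = "\<lambda>us j. MVar (j + 1) - in_var 0 (us ! j) :: real mpoly"
  have len: "length us = N - 1" "length us' = N - 1"
    and eq: "insert (in_var 0 w) (?v us ` {0..<N - 1}) = insert (in_var 0 w') (?v us' ` {0..<N - 1})"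
    using assms by (auto simp: has_shape_def in_y1_eq_in_var)
  have "in_var 0 w \<in> insert (in_var 0 w') (?v us' ` {0..<N - 1})" using eq by blast
  then have "w = w'" using in_var_neq_var_minus by auto
  moreover have "us = us'"
  proof (rule nth_equalityI)
    fix j assume "j < length us"
    then have "?v us j \<in> insert (in_var 0 w') (?v us' ` {0..<N - 1})" using eq len by auto
    then obtain j' where j': "j' < N - 1" "?v us j = ?v us' j'"
      using in_var_neq_var_minus[of "j + 1" w' "us ! j"] by auto
    from arg_cong[OF j'(2), of "\<lambda>p. Poly_Mapping.lookup p (Poly_Mapping.single (j + 1) 1)"] have "j' = j"
      using lookup_var_minus[of "j + 1" "j + 1" "us ! j"] lookup_var_minus[of "j + 1" "j' + 1" "us' ! j'"]
      by (simp split: if_splits)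
    with j'(2) show "us ! j = us' ! j" by simp
  qed (use len in simp)
  ultimately show ?thesis by blast
qed

text \<open>All listed polynomials vanish on \<open>V\<close>. Their leading monomials are \<open>y\<^sub>1\<^sup>d\<close> with \<open>d = card V\<close> and the other
  variables. They suffice, because a member of the ideal whose leading monomial involves only \<open>y\<^sub>1\<close> is
  itself a polynomial in \<open>y\<^sub>1\<close>, the smallest variable, and it has the \<open>d\<close> distinct first coordinates as
  roots, hence degree at least \<open>d\<close>. Reducedness is the degree bound for the interpolation polynomials.\<close>

theorem shape_lemma:
  assumes V: "finite V" "V \<noteq> {}" "V \<subseteq> carrier_vec N" "map_vec cnj ` V \<subseteq> V" and "N \<ge> 1"
    and sep: "inj_on (\<lambda>a. a $ 0) V"
  obtains w us where "length us = N - 1" "degree w = card V" "w \<noteq> 0"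
    "\<And>t. poly (map_poly of_real w) t = 0 \<longleftrightarrow> t \<in> (\<lambda>a. a $ 0) ` V"
    "\<And>j. j < N - 1 \<Longrightarrow> degree (us ! j) < card V"
    "\<And>j a. j < N - 1 \<Longrightarrow> a \<in> V \<Longrightarrow> a $ (j + 1) = poly (map_poly of_real (us ! j)) (a $ 0)"
    "has_shape N (reduced_groebner_basis (vanishing_ideal N V)) (w, us)"
proof -
  define S where "S = (\<lambda>a. a $ 0) ` V"
  have S: "finite S" "S \<noteq> {}" "cnj ` S = S"
    unfolding S_def using V cnj_coordinates[OF V(3,4)] \<open>N \<ge> 1\<close> by auto
  have cardS: "card S = card V" unfolding S_def by (rule card_image[OF sep])
  obtain w where w: "map_poly of_real w = (\<Prod>x\<in>S. [:- x, 1:])" "degree w = card S" "lead_coeff w = 1"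
    using real_poly_with_roots[OF S(1,3)] by blast
  have roots: "poly (map_poly of_real w) t = 0 \<longleftrightarrow> t \<in> S" for t
    unfolding w(1) by (rule poly_linear_prod_eq_0_iff[OF S(1)])
  have wnz: "w \<noteq> 0" using w(3) by auto
  have "\<exists>u. degree u < card S \<and> (\<forall>a\<in>V. a $ (j + 1) = poly (map_poly of_real u) (a $ 0))"
    if j: "j < N - 1" for j
  proof -
    let ?a = "the_inv_into V (\<lambda>a. a $ 0)"
    have inv: "?a (a $ 0) = a" if "a \<in> V" for a
      using that by (rule the_inv_into_f_f[OF sep])
    \<comment> \<open>The point with first coordinate \<open>cnj x\<close> is the conjugate of the one with first coordinate \<open>x\<close>.\<close>
    have "?a (cnj x) $ (j + 1) = cnj (?a x $ (j + 1))" if "x \<in> S" for x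
    proof -
      obtain a where a: "a \<in> V" "x = a $ 0" using \<open>x \<in> S\<close> by (auto simp: S_def)
      then have "map_vec cnj a \<in> V" "map_vec cnj a $ 0 = cnj x" "dim_vec a = N"
        using V \<open>N \<ge> 1\<close> by auto
      then show ?thesis using inv[of "map_vec cnj a"] inv[OF a(1)] a(2) j by simp
    qed
    then obtain u where u: "degree u < card S"
      "\<And>x. x \<in> S \<Longrightarrow> poly (map_poly complex_of_real u) x = ?a x $ (j + 1)"
      using real_interpolation_poly[OF S, of "\<lambda>x. ?a x $ (j + 1)"] by blast
    then show ?thesis using inv by (intro exI[of _ u]) (auto simp: S_def)
  qed
  then obtain u where u: "\<And>j. j < N - 1 \<Longrightarrow> degree (u j) < card S"
    "\<And>j a. j < N - 1 \<Longrightarrow> a \<in> V \<Longrightarrow> a $ (j + 1) = poly (map_poly of_real (u j)) (a $ 0)"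
    by metis
  define us where "us = map u [0..<N - 1]"
  define v :: "nat \<Rightarrow> real mpoly" where "v j = MVar (j + 1) - in_var 0 (u j)" for j
  define G where "G = insert (in_var 0 w) (v ` {0..<N - 1})"
  have shape: "has_shape N G (w, us)"
    by (auto simp: has_shape_def us_def G_def in_y1_eq_in_var v_def)
  have lead_w: "lead_mono (in_var 0 w) = Poly_Mapping.single 0 (card S)"
    using lead_mono_in_var[OF wnz] w(2) by simp
  have lead_v: "lead_mono (v j) = Poly_Mapping.single (j + 1) 1" for j
    unfolding v_def by (rule lead_mono_var_minus) simp
  have cardpos: "card S > 0" using S by (simp add: card_gt_0_iff)
  have v1: "Poly_Mapping.lookup (v j) (Poly_Mapping.single (j + 1) 1) = 1" for j
    unfolding v_def using lookup_var_minus[of "j + 1" "j + 1" "u j"] by simp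
  have "is_reduced_groebner_basis G (vanishing_ideal N V)"
    unfolding is_reduced_groebner_basis_def is_groebner_basis_def
  proof (intro conjI ballI impI)
    show "finite G" by (simp add: G_def)
    have "v j \<in> vanishing_ideal N V" if "j < N - 1" for j
    proof -
      have "mvars (v j) \<subseteq> {j + 1, 0}"
        unfolding v_def using mvars_diff[of "MVar (j + 1)" "in_var 0 (u j)"] mvars_in_var[of 0 "u j"]
        unfolding mvars_MVar by blast
      also have "\<dots> \<subseteq> {..<N}" using that by auto
      finally have "mvars (v j) \<subseteq> {..<N}" .
      then show ?thesis
        using u(2)[OF that] by (auto simp: vanishing_ideal_def v_def ce.hom_minus complex_eval_in_var)
    qed
    moreover have "in_var 0 w \<in> vanishing_ideal N V"
      using mvars_in_var[of 0 w] \<open>N \<ge> 1\<close> roots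
      by (auto simp: vanishing_ideal_def complex_eval_in_var S_def)
    ultimately show "G \<subseteq> vanishing_ideal N V" by (auto simp: G_def)
    have "v j \<noteq> 0" for j using v1[of j] by auto
    then show "0 \<notin> G" using wnz by (auto simp: G_def)
  next
    fix p assume p: "p \<in> vanishing_ideal N V" "p \<noteq> 0"
    let ?m = "lead_mono p"
    have keys: "Poly_Mapping.keys ?m \<subseteq> {..<N}"
      using p lead_mono_mvars by (auto simp: vanishing_ideal_def)
    show "\<exists>g\<in>G. mono_dvd (lead_mono g) ?m"
    proof (cases "Poly_Mapping.keys ?m \<subseteq> {0}")
      case False
      then obtain i where i: "i \<in> Poly_Mapping.keys ?m" "i \<noteq> 0" by auto
      then have "i < N" using keys by auto
      then have "v (i - 1) \<in> G" using i(2) by (auto simp: G_def)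
      moreover have "mono_dvd (lead_mono (v (i - 1))) ?m"
        using i by (auto simp: lead_v mono_dvd_def lookup_single when_def in_keys_iff)
      ultimately show ?thesis by blast
    next
      case True
      \<comment> \<open>A smaller monomial cannot involve a variable that is larger than all variables of the leading one.\<close>
      have "Poly_Mapping.keys k \<subseteq> {0}" if k: "k \<in> Poly_Mapping.keys p" for k
      proof (cases "k = ?m")
        case False
        then obtain l where l: "Poly_Mapping.lookup k l < Poly_Mapping.lookup ?m l"
          "\<And>j. j > l \<Longrightarrow> Poly_Mapping.lookup k j = Poly_Mapping.lookup ?m j"
          using lead_mono_greatest[OF p(2) k] by (auto simp: lex_less_def)
        then have "l \<in> Poly_Mapping.keys ?m" by (simp add: in_keys_iff)
        then have "l = 0" using True by auto
        have "j \<notin> Poly_Mapping.keys k" if "j \<noteq> 0" for j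
          using l(2)[of j] True that \<open>l = 0\<close> by (auto simp: in_keys_iff)
        then show ?thesis by auto
      qed (use True in simp)
      then have "mvars p \<subseteq> {0}" by (auto simp: mvars_def)
      then obtain q where q: "p = in_var 0 q" by (rule univariate_as_in_var)
      have "q \<noteq> 0" using p(2) q by auto
      let ?Q = "map_poly complex_of_real q"
      have degQ: "degree ?Q = degree q" by (rule degree_map_poly) simp
      have "?Q \<noteq> 0" using \<open>q \<noteq> 0\<close> by (simp add: map_poly_eq_0_iff)
      have "S \<subseteq> {x. poly ?Q x = 0}"
        using p(1) unfolding vanishing_ideal_def S_def q by (auto simp: complex_eval_in_var)
      then have "card S \<le> card {x. poly ?Q x = 0}"
        by (intro card_mono poly_roots_finite \<open>?Q \<noteq> 0\<close>)
      also have "\<dots> \<le> degree q"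
        using card_poly_roots_bound[OF \<open>?Q \<noteq> 0\<close>] degQ by simp
      finally have "mono_dvd (lead_mono (in_var 0 w)) ?m"
        unfolding lead_w q lead_mono_in_var[OF \<open>q \<noteq> 0\<close>]
        by (auto simp: mono_dvd_def lookup_single when_def)
      then show ?thesis by (auto simp: G_def)
    qed
  next
    fix g assume "g \<in> G"
    then show "Poly_Mapping.lookup g (lead_mono g) = 1"
      using w(2,3) v1 unfolding G_def by (auto simp: lead_w lead_v lookup_in_var)
  next
    fix g h m assume g: "g \<in> G" and h: "h \<in> G - {g}" and m: "m \<in> Poly_Mapping.keys g"
    have dvd_single: "\<not> mono_dvd (Poly_Mapping.single i k) (Poly_Mapping.single j l)"
      if "k > 0" "i \<noteq> j \<or> k > l" for i j k l
    proof
      assume "mono_dvd (Poly_Mapping.single i k) (Poly_Mapping.single j l)"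
      then have "Poly_Mapping.lookup (Poly_Mapping.single i k) i \<le> Poly_Mapping.lookup (Poly_Mapping.single j l) i"
        unfolding mono_dvd_def by blast
      then show False using that by (auto simp: lookup_single when_def split: if_splits)
    qed
    show "\<not> mono_dvd (lead_mono h) m"
    proof (cases "g = in_var 0 w")
      case True
      then obtain k where "m = Poly_Mapping.single 0 k" using m keys_in_var by blast
      moreover obtain j where "h = v j" using h True by (auto simp: G_def)
      ultimately show ?thesis by (auto simp: lead_v dvd_single)
    next
      case False
      then obtain j where j: "g = v j" "j < N - 1" using g by (auto simp: G_def)
      consider (top) "m = Poly_Mapping.single (j + 1) 1" | (low) k where "m = Poly_Mapping.single 0 k" "k \<le> degree (u j)"
        using m keys_var_minus[of m "j + 1" "u j"] unfolding j(1) v_def by blast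
      then show ?thesis
      proof cases
        case top
        show ?thesis
        proof (cases "h = in_var 0 w")
          case True
          then show ?thesis
            using dvd_single[where k = "card S" and i = 0 and j = "j + 1" and l = 1] cardpos
            by (simp add: top lead_w)
        next
          case False
          then obtain j' where "h = v j'" "j' \<noteq> j" using h j by (auto simp: G_def)
          then show ?thesis
            using dvd_single[where k = 1 and i = "j' + 1" and j = "j + 1" and l = 1] by (simp add: top lead_v)
        qed
      next
        case low
        then have "k < card S" using u(1)[OF j(2)] by simp
        show ?thesis
        proof (cases "h = in_var 0 w")
          case True
          then show ?thesis
            using \<open>k < card S\<close> dvd_single[where k = "card S" and i = 0 and j = 0 and l = k]
            by (simp add: low(1) lead_w)
        next
          case False
          then obtain j' where "h = v j'" using h by (auto simp: G_def)
          then show ?thesis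
            using dvd_single[where k = 1 and i = "j' + 1" and j = 0 and l = k] by (simp add: low(1) lead_v)
        qed
      qed
    qed
  qed
  then have "reduced_groebner_basis (vanishing_ideal N V) = G"
    by (rule reduced_groebner_basis_eqI[OF ideal_vanishing_ideal])
  then show ?thesis
    using shape u w(2) cardS wnz roots by (intro that[of us w]) (simp_all add: us_def S_def)
qed

lemma has_shape_imp_separating:
  assumes V: "finite V" "V \<subseteq> carrier_vec N" "map_vec cnj ` V \<subseteq> V" and "N \<ge> 1"
    and shape: "has_shape N (reduced_groebner_basis (vanishing_ideal N V)) wu"
  shows "inj_on (\<lambda>a. a $ 0) V"
proof (rule inj_onI)
  obtain w us where wu: "wu = (w, us)" by fastforce
  obtain G where G: "is_reduced_groebner_basis G (vanishing_ideal N V)"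
    using vanishing_ideal_reduced_groebner_basis_exists[OF V] by blast
  have "reduced_groebner_basis (vanishing_ideal N V) = G"
    by (rule reduced_groebner_basis_eqI[OF ideal_vanishing_ideal G])
  moreover have "G \<subseteq> vanishing_ideal N V"
    using G by (auto simp: is_reduced_groebner_basis_def is_groebner_basis_def)
  ultimately have "MVar (j + 1) - in_var 0 (us ! j) \<in> vanishing_ideal N V" if "j < N - 1" for j
    using shape that unfolding wu by (auto simp: has_shape_def in_y1_eq_in_var)
  then have coord: "a $ (j + 1) = poly (map_poly of_real (us ! j)) (a $ 0)" if "j < N - 1" "a \<in> V" for j a
    using that by (fastforce simp: vanishing_ideal_def ce.hom_minus complex_eval_in_var)
  fix a b assume ab: "a \<in> V" "b \<in> V" "a $ 0 = b $ 0"
  then have dim: "dim_vec a = N" "dim_vec b = N"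
    using V(2) by (meson carrier_vecD subsetD)+
  show "a = b"
  proof (rule eq_vecI)
    show "dim_vec a = dim_vec b" using dim by simp
    fix i assume "i < dim_vec b"
    then have "i < N" using dim by simp
    show "a $ i = b $ i"
    proof (cases i)
      case 0
      then show ?thesis using ab by simp
    next
      case (Suc j)
      then show ?thesis using coord[of j a] coord[of j b] ab \<open>i < N\<close> by simp
    qed
  qed
qed

section \<open>The change of variables\<close>

lemma step_matrix_carrier [simp]: "step_matrix N s \<in> carrier_mat N N"
  by (simp add: step_matrix_def)

text \<open>The step matrix is unitriangular, so it has determinant one.\<close>

lemma H_matrix_inverse:
  shows "H_matrix N s \<in> carrier_mat N N" "step_matrix N s * H_matrix N s = 1\<^sub>m N"
    "H_matrix N s * step_matrix N s = 1\<^sub>m N"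
proof -
  let ?A = "step_matrix N s"
  have "upper_triangular ?A"
    by (rule upper_triangularI) (auto simp: step_matrix_def)
  then have "det ?A = prod_list (diag_mat ?A)"
    by (rule det_upper_triangular[OF _ step_matrix_carrier])
  also have "\<dots> = prod_list (map (\<lambda>_. 1) [0..<N])"
    by (intro arg_cong[of _ _ prod_list]) (auto simp: diag_mat_def step_matrix_def)
  also have "\<dots> = 1"
    by (simp add: map_replicate_const)
  finally have "?A \<in> Units (ring_mat TYPE(real) N ())"
    by (intro det_non_zero_imp_unit[OF step_matrix_carrier]) simp
  then obtain B where "mat_inverse ?A = Some B"
    using mat_inverse(1)[OF step_matrix_carrier, of N s "()"] by (cases "mat_inverse ?A") auto
  with mat_inverse(2)[OF step_matrix_carrier this]
  show "H_matrix N s \<in> carrier_mat N N" "?A * H_matrix N s = 1\<^sub>m N" "H_matrix N s * ?A = 1\<^sub>m N"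
    by (auto simp: H_matrix_def)
qed

lemma of_real_mult_mat_vec:
  assumes "A \<in> carrier_mat N N" "v \<in> carrier_vec N"
  shows "map_mat complex_of_real A *\<^sub>v map_vec of_real v = map_vec of_real (A *\<^sub>v v)"
  using assms by (intro eq_vecI) (auto simp: scalar_prod_def)

lemma of_real_H_step:
  assumes "y \<in> carrier_vec N"
  shows "map_mat complex_of_real (H_matrix N s) *\<^sub>v (map_mat complex_of_real (step_matrix N s) *\<^sub>v y) = y"
    and "map_mat complex_of_real (step_matrix N s) *\<^sub>v (map_mat complex_of_real (H_matrix N s) *\<^sub>v y) = y"
proof -
  have *: "map_mat complex_of_real A *\<^sub>v (map_mat complex_of_real B *\<^sub>v y) = y"
    if "A \<in> carrier_mat N N" "B \<in> carrier_mat N N" "A * B = 1\<^sub>m N" for A B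
  proof -
    have "map_mat complex_of_real A *\<^sub>v (map_mat complex_of_real B *\<^sub>v y)
        = (map_mat complex_of_real A * map_mat complex_of_real B) *\<^sub>v y"
      using that assms by (intro assoc_mult_mat_vec[symmetric]) auto
    also have "map_mat complex_of_real A * map_mat complex_of_real B = map_mat complex_of_real (1\<^sub>m N)"
      unfolding that(3)[symmetric] by (rule of_real_hom.mat_hom_mult[OF that(1,2), symmetric])
    also have "\<dots> *\<^sub>v y = y"
      using assms by (simp add: of_real_hom.mat_hom_one)
    finally show ?thesis .
  qed
  show "map_mat complex_of_real (H_matrix N s) *\<^sub>v (map_mat complex_of_real (step_matrix N s) *\<^sub>v y) = y"
    and "map_mat complex_of_real (step_matrix N s) *\<^sub>v (map_mat complex_of_real (H_matrix N s) *\<^sub>v y) = y"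
    by (intro * H_matrix_inverse step_matrix_carrier)+
qed

lemma change_vars_component:
  assumes "H \<in> carrier_mat N N" "i < N"
  shows "(map_mat MConst H *\<^sub>v vec N MVar) $ i = (\<Sum>j<N. MConst (H $$ (i, j)) * MVar j)"
  using assms by (simp add: scalar_prod_def lessThan_atLeast0)

lemma mvars_sum:
  assumes "\<And>x. x \<in> X \<Longrightarrow> mvars (g x) \<subseteq> A"
  shows "mvars (sum g X) \<subseteq> A"
  using assms
proof (induction X rule: infinite_finite_induct)
  case (insert x X)
  then show ?case using mvars_add[of "g x" "sum g X"] by auto
qed auto

lemma mvars_change_vars:
  assumes "H \<in> carrier_mat N N" "mvars p \<subseteq> {..<N}"
  shows "mvars (change_vars N H p) \<subseteq> {..<N}"
  unfolding change_vars_def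
proof (rule mvars_mpoly_eval)
  fix i assume "i \<in> mvars p"
  then have "i < N" using assms(2) by auto
  show "mvars ((map_mat MConst H *\<^sub>v vec N MVar) $ i) \<subseteq> {..<N}"
    unfolding change_vars_component[OF assms(1) \<open>i < N\<close>]
  proof (rule mvars_sum)
    fix j assume "j \<in> {..<N}"
    then show "mvars (MConst (H $$ (i, j)) * MVar j) \<subseteq> {..<N}"
      using mvars_mult[of "MConst (H $$ (i, j))" "MVar j"] by auto
  qed
qed

lemma complex_eval_change_vars:
  assumes H: "H \<in> carrier_mat N N" and p: "mvars p \<subseteq> {..<N}" and y: "y \<in> carrier_vec N"
  shows "complex_eval (change_vars N H p) y = complex_eval p (map_mat of_real H *\<^sub>v y)"
proof -
  have "complex_eval (change_vars N H p) y
      = mpoly_eval (\<lambda>c. complex_eval (MConst c) y)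
          (\<lambda>i. complex_eval ((map_mat MConst H *\<^sub>v vec N MVar) $ i) y) p"
    unfolding change_vars_def by (rule hom_mpoly_eval) (rule comm_ring_hom_complex_eval)
  also have "\<dots> = complex_eval p (map_mat of_real H *\<^sub>v y)"
    unfolding complex_eval_def[of p] complex_eval_MConst
  proof (rule mpoly_eval_cong)
    fix i assume "i \<in> mvars p"
    then have "i < N" using p by auto
    show "complex_eval ((map_mat MConst H *\<^sub>v vec N MVar) $ i) y = (map_mat of_real H *\<^sub>v y) $ i"
      unfolding change_vars_component[OF H \<open>i < N\<close>]
      using \<open>i < N\<close> H y by (simp add: ce.hom_sum ce.hom_mult scalar_prod_def lessThan_atLeast0)
  qed
  finally show ?thesis .
qed

section \<open>The variety of the complementarity problem\<close>

lemma cp_generators_mvars: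
  assumes "polynomial_mapping n f"
  shows "set (cp_generators n f) \<subseteq> {p. mvars p \<subseteq> {..<3 * n}}"
proof -
  have f: "mvars (f i) \<subseteq> {..<3 * n}" if "i < n" for i
    using assms that by (fastforce simp: polynomial_mapping_def)
  have v: "mvars (MVar i :: real mpoly) \<subseteq> {..<3 * n}" if "i < 3 * n" for i
    using that by simp
  have "mvars (MVar i * f i) \<subseteq> {..<3 * n}" if "i < n" for i
  proof -
    have "i < 3 * n" using that by simp
    then show ?thesis using mvars_mult[of "MVar i" "f i"] v[of i] f[OF that] by blast
  qed
  moreover have "mvars ((MVar (n + i))\<^sup>2 - MVar i :: real mpoly) \<subseteq> {..<3 * n}" if "i < n" for i
  proof -
    have "i < 3 * n" "n + i < 3 * n" using that by simp_all
    then show ?thesis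
      using mvars_diff[of "(MVar (n + i))\<^sup>2" "MVar i :: real mpoly"]
        mvars_power[of "MVar (n + i) :: real mpoly" 2] v[of i] v[of "n + i"] by blast
  qed
  moreover have "mvars ((MVar (2 * n + i))\<^sup>2 - f i) \<subseteq> {..<3 * n}" if "i < n" for i
  proof -
    have "2 * n + i < 3 * n" using that by simp
    then show ?thesis
      using mvars_diff[of "(MVar (2 * n + i))\<^sup>2" "f i"]
        mvars_power[of "MVar (2 * n + i) :: real mpoly" 2] v[of "2 * n + i"] f[OF that] by blast
  qed
  ultimately show ?thesis by (simp add: cp_generators_def image_subset_iff)
qed

lemma cp_variety_iff:
  assumes "polynomial_mapping n f"
  shows "a \<in> cp_variety n f \<longleftrightarrow> a \<in> carrier_vec (3 * n) \<and>
    (\<forall>i<n. a $ i * complex_eval (f i) a = 0 \<and> (a $ (n + i))\<^sup>2 = a $ i \<and>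
      (a $ (2 * n + i))\<^sup>2 = complex_eval (f i) a)"
  unfolding cp_variety_def cp_ideal_def complex_zeros_Idl[OF cp_generators_mvars[OF assms]]
  by (auto simp: cp_generators_def ce.hom_mult ce.hom_minus ce.hom_power ball_Un)

lemma complex_eval_first_vars:
  assumes "mvars p \<subseteq> {..<n}" "\<And>i. i < n \<Longrightarrow> a $ i = b $ i"
  shows "complex_eval p a = complex_eval p b"
  unfolding complex_eval_def using assms by (intro mpoly_eval_cong) auto

lemma real_eval_first_vars:
  assumes "mvars p \<subseteq> {..<n}" "\<And>i. i < n \<Longrightarrow> a $ i = b $ i"
  shows "real_eval p a = real_eval p b"
  unfolding real_eval_def using assms by (intro mpoly_eval_cong) auto

lemma finite_complex_square_roots: "finite {z::complex. z\<^sup>2 = c}"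
proof (rule finite_subset)
  show "{z::complex. z\<^sup>2 = c} \<subseteq> {csqrt c, - csqrt c}"
  proof
    fix z assume "z \<in> {z::complex. z\<^sup>2 = c}"
    then have "z\<^sup>2 = (csqrt c)\<^sup>2" by simp
    then show "z \<in> {csqrt c, - csqrt c}" by (simp only: power2_eq_iff) simp
  qed
qed simp

lemma finite_cp_variety:
  assumes f: "polynomial_mapping n f" and "D0 n f"
  shows "finite (cp_variety n f)"
proof -
  define X where "X = {x \<in> carrier_vec n. \<forall>i<n. x $ i * complex_eval (f i) x = 0}"
  have "finite X" using assms(2) by (simp add: D0_def X_def)
  define B where "B = (\<Union>x\<in>X. \<Union>i<n. {x $ i, complex_eval (f i) x})"
  define C where "C = B \<union> (\<Union>b\<in>B. {z. z\<^sup>2 = b})"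
  have "finite B" using \<open>finite X\<close> by (auto simp: B_def)
  then have "finite C" by (auto simp: C_def finite_complex_square_roots)
  have "cp_variety n f \<subseteq> vec_of_list ` {xs. set xs \<subseteq> C \<and> length xs = 3 * n}"
  proof
    fix a assume a: "a \<in> cp_variety n f"
    then have dim: "a \<in> carrier_vec (3 * n)" and
      eqs: "\<And>i. i < n \<Longrightarrow> a $ i * complex_eval (f i) a = 0 \<and> (a $ (n + i))\<^sup>2 = a $ i \<and>
        (a $ (2 * n + i))\<^sup>2 = complex_eval (f i) a"
      using cp_variety_iff[OF f] by auto
    let ?x = "vec n (\<lambda>i. a $ i)"
    have fx: "complex_eval (f i) ?x = complex_eval (f i) a" if "i < n" for i
      using f that by (intro complex_eval_first_vars[of _ n]) (auto simp: polynomial_mapping_def)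
    have "?x \<in> X" using eqs fx by (auto simp: X_def)
    then have "a $ i \<in> B \<and> complex_eval (f i) a \<in> B" if "i < n" for i
      unfolding B_def using that fx[OF that] by (auto intro!: bexI[of _ ?x] bexI[of _ i])
    then have 1: "a $ i \<in> C" "a $ (n + i) \<in> C" "a $ (2 * n + i) \<in> C" if "i < n" for i
      using eqs[OF that] that by (auto simp: C_def)
    have "a $ j \<in> C" if "j < 3 * n" for j
    proof -
      have "j < n \<or> (n \<le> j \<and> j - n < n) \<or> (2 * n \<le> j \<and> j - 2 * n < n)" using that by arith
      then consider "j < n" | "n \<le> j" "j - n < n" | "2 * n \<le> j" "j - 2 * n < n" by blast
      then show ?thesis using 1(1)[of j] 1(2)[of "j - n"] 1(3)[of "j - 2 * n"] by cases auto
    qed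
    then have "set (list_of_vec a) \<subseteq> C" "length (list_of_vec a) = 3 * n"
      using dim by (auto simp: set_list_of_vec vec_set_def)
    then show "a \<in> vec_of_list ` {xs. set xs \<subseteq> C \<and> length xs = 3 * n}"
      by (intro image_eqI[of _ _ "list_of_vec a"]) (auto simp: vec_list)
  qed
  moreover have "finite {xs. set xs \<subseteq> C \<and> length xs = 3 * n}"
    using \<open>finite C\<close> by (rule finite_lists_length_eq)
  ultimately show ?thesis by (meson finite_imageI finite_subset)
qed

lemma cp_variety_nonempty:
  assumes f: "polynomial_mapping n f"
  shows "cp_variety n f \<noteq> {}"
proof -
  let ?c = "\<lambda>i. complex_eval (f i) (0\<^sub>v n)"
  let ?a = "vec (3 * n) (\<lambda>j. if j < 2 * n then 0 else csqrt (?c (j - 2 * n)))"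
  have "complex_eval (f i) ?a = ?c i" if "i < n" for i
    using f that by (intro complex_eval_first_vars[of _ n]) (auto simp: polynomial_mapping_def)
  then have "?a \<in> cp_variety n f"
    unfolding cp_variety_iff[OF f] by auto
  then show ?thesis by blast
qed

lemma complex_zeros_cnj_closed:
  assumes "\<And>p. p \<in> I \<Longrightarrow> mvars p \<subseteq> {..<N}"
  shows "map_vec cnj ` complex_zeros N I \<subseteq> complex_zeros N I"
  using assms by (auto simp: complex_zeros_def complex_eval_cnj)

text \<open>The sums over \<open>j\<close> are the values at \<open>s\<close> of polynomials with the coordinates of the points as
  coefficients. Distinct points give distinct polynomials, which agree at finitely many \<open>s\<close>.\<close>

lemma separating_step_exists:
  assumes V: "finite V" "V \<subseteq> carrier_vec N"
  shows "\<exists>s. inj_on (\<lambda>a. \<Sum>j<N. of_real (real s ^ j) * a $ j) (V :: complex vec set)"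
proof -
  define P where "P a b = (\<Sum>j<N. monom (a $ j - b $ j) j)" for a b :: "complex vec"
  have poly: "poly (P a b) t = (\<Sum>j<N. t ^ j * a $ j) - (\<Sum>j<N. t ^ j * b $ j)" for a b t
    by (simp add: P_def poly_sum poly_monom sum_subtractf[symmetric] algebra_simps)
  have nz: "P a b \<noteq> 0" if "a \<in> V" "b \<in> V" "a \<noteq> b" for a b
  proof
    assume "P a b = 0"
    have "a $ i = b $ i" if "i < N" for i
    proof -
      have "coeff (P a b) i = a $ i - b $ i"
        using that by (simp add: P_def coeff_sum)
      with \<open>P a b = 0\<close> show ?thesis by simp
    qed
    moreover have "dim_vec a = N" "dim_vec b = N"
      using \<open>a \<in> V\<close> \<open>b \<in> V\<close> V(2) by (meson carrier_vecD subsetD)+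
    ultimately show False using \<open>a \<noteq> b\<close> by (metis eq_vecI)
  qed
  define Z where "Z = (\<Union>a\<in>V. \<Union>b\<in>V - {a}. {t. poly (P a b) t = 0})"
  have "finite Z"
    unfolding Z_def using V(1) nz by (intro finite_UN_I poly_roots_finite) auto
  moreover have "infinite (range (of_nat :: nat \<Rightarrow> complex))"
    by (simp add: range_inj_infinite inj_of_nat)
  ultimately obtain s :: nat where s: "of_nat s \<notin> Z"
    by (metis finite_subset image_subsetI)
  have "inj_on (\<lambda>a. \<Sum>j<N. of_real (real s ^ j) * a $ j) V"
  proof (rule inj_onI, rule ccontr)
    fix a b assume ab: "a \<in> V" "b \<in> V" "a \<noteq> b"
      "(\<Sum>j<N. of_real (real s ^ j) * a $ j) = (\<Sum>j<N. of_real (real s ^ j) * b $ j)"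
    then have "poly (P a b) (of_nat s) = 0" by (simp add: poly)
    then show False using s ab by (auto simp: Z_def)
  qed
  then show ?thesis by blast
qed

section \<open>Correctness of the algorithm\<close>

definition step_variety :: "nat \<Rightarrow> (nat \<Rightarrow> real mpoly) \<Rightarrow> nat \<Rightarrow> complex vec set" where
  "step_variety n f s = complex_zeros (3 * n) (step_ideal n f s)"

lemma step_generators_mvars:
  assumes "polynomial_mapping n f"
  shows "change_vars (3 * n) (H_matrix (3 * n) s) ` set (cp_generators n f) \<subseteq> {p. mvars p \<subseteq> {..<3 * n}}"
  using cp_generators_mvars[OF assms] mvars_change_vars[OF H_matrix_inverse(1)] by blast

lemma step_basis_eq:
  assumes "polynomial_mapping n f"
  shows "step_basis n f s = reduced_groebner_basis (vanishing_ideal (3 * n) (step_variety n f s))"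
  unfolding step_basis_def step_variety_def vanishing_ideal_def step_ideal_def
    radical_eq_vanishing[OF ideal_Idl_mpoly_ring[OF step_generators_mvars[OF assms]]] ..

lemma step_variety_iff:
  assumes f: "polynomial_mapping n f"
  shows "y \<in> step_variety n f s \<longleftrightarrow>
    y \<in> carrier_vec (3 * n) \<and> map_mat of_real (H_matrix (3 * n) s) *\<^sub>v y \<in> cp_variety n f"
proof (cases "y \<in> carrier_vec (3 * n)")
  case True
  let ?N = "3 * n" and ?H = "H_matrix (3 * n) s"
  have "complex_eval (change_vars ?N ?H p) y = complex_eval p (map_mat of_real ?H *\<^sub>v y)"
    if "p \<in> set (cp_generators n f)" for p
    using cp_generators_mvars[OF f] that True by (intro complex_eval_change_vars H_matrix_inverse) auto
  moreover have "map_mat of_real ?H *\<^sub>v y \<in> carrier_vec ?N"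
    using H_matrix_inverse(1)[of ?N s] True by (intro mult_mat_vec_carrier) auto
  ultimately show ?thesis
    using True unfolding step_variety_def step_ideal_def cp_variety_def cp_ideal_def
      complex_zeros_Idl[OF cp_generators_mvars[OF f]] complex_zeros_Idl[OF step_generators_mvars[OF f]]
    by simp
qed (simp add: step_variety_def complex_zeros_def)

lemma step_variety_eq_image:
  assumes f: "polynomial_mapping n f"
  shows "step_variety n f s = (\<lambda>x. map_mat of_real (step_matrix (3 * n) s) *\<^sub>v x) ` cp_variety n f"
proof (intro equalityI subsetI)
  fix y assume "y \<in> step_variety n f s"
  then have "y \<in> carrier_vec (3 * n)" "map_mat of_real (H_matrix (3 * n) s) *\<^sub>v y \<in> cp_variety n f"
    by (simp_all add: step_variety_iff[OF f])
  then show "y \<in> (\<lambda>x. map_mat of_real (step_matrix (3 * n) s) *\<^sub>v x) ` cp_variety n f"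
    using of_real_H_step(2)[of y "3 * n" s] by (intro image_eqI) auto
next
  fix y assume "y \<in> (\<lambda>x. map_mat of_real (step_matrix (3 * n) s) *\<^sub>v x) ` cp_variety n f"
  then obtain x where x: "x \<in> cp_variety n f" "y = map_mat of_real (step_matrix (3 * n) s) *\<^sub>v x" by auto
  then have xc: "x \<in> carrier_vec (3 * n)" by (simp add: cp_variety_def complex_zeros_def)
  then have "y \<in> carrier_vec (3 * n)"
    unfolding x(2) by (intro mult_mat_vec_carrier) (auto simp: step_matrix_def)
  then show "y \<in> step_variety n f s"
    using x of_real_H_step(1)[OF xc] by (simp add: step_variety_iff[OF f])
qed

lemma step_variety_props:
  assumes f: "polynomial_mapping n f" and D0: "D0 n f"
  shows "finite (step_variety n f s)" "step_variety n f s \<noteq> {}" "step_variety n f s \<subseteq> carrier_vec (3 * n)"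
    "map_vec cnj ` step_variety n f s \<subseteq> step_variety n f s"
    "card (step_variety n f s) = card (cp_variety n f)"
proof -
  show "finite (step_variety n f s)" "step_variety n f s \<noteq> {}"
    unfolding step_variety_eq_image[OF f] using finite_cp_variety[OF f D0] cp_variety_nonempty[OF f] by auto
  show "step_variety n f s \<subseteq> carrier_vec (3 * n)"
    by (auto simp: step_variety_def complex_zeros_def)
  show "map_vec cnj ` step_variety n f s \<subseteq> step_variety n f s"
    unfolding step_variety_def
    using mpoly_ring_idealD(1)[OF ideal_Idl_mpoly_ring[OF step_generators_mvars[OF f]]]
    by (intro complex_zeros_cnj_closed) (auto simp: step_ideal_def)
  have "inj_on (\<lambda>x. map_mat complex_of_real (step_matrix (3 * n) s) *\<^sub>v x) (cp_variety n f)"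
  proof (rule inj_on_inverseI)
    fix x assume "x \<in> cp_variety n f"
    then show "map_mat of_real (H_matrix (3 * n) s) *\<^sub>v (map_mat of_real (step_matrix (3 * n) s) *\<^sub>v x) = x"
      by (intro of_real_H_step(1)) (simp add: cp_variety_def complex_zeros_def)
  qed
  then show "card (step_variety n f s) = card (cp_variety n f)"
    unfolding step_variety_eq_image[OF f] by (rule card_image)
qed

text \<open>This characterises the exit condition of the loop by the points alone. It holds for every \<open>s\<close>, which
  is needed because the first successful round need not be the one whose success is established.\<close>

lemma has_shape_iff_separating:
  assumes n: "n \<ge> 1" and f: "polynomial_mapping n f" and D0: "D0 n f"
  shows "(\<exists>wu. has_shape (3 * n) (step_basis n f s) wu) \<longleftrightarrow> inj_on (\<lambda>a. a $ 0) (step_variety n f s)"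
proof -
  note V = step_variety_props[OF f D0, of s]
  have N: "3 * n \<ge> 1" using n by simp
  show ?thesis
    unfolding step_basis_eq[OF f]
    using has_shape_imp_separating[OF V(1,3,4) N] shape_lemma[OF V(1,2,3,4) N] by metis
qed

lemma some_step_has_shape:
  assumes n: "n \<ge> 1" and f: "polynomial_mapping n f" and D0: "D0 n f"
  shows "\<exists>s wu. has_shape (3 * n) (step_basis n f s) wu"
proof -
  let ?V = "cp_variety n f"
  have V: "?V \<subseteq> carrier_vec (3 * n)" by (auto simp: cp_variety_def complex_zeros_def)
  obtain s where s: "inj_on (\<lambda>a. \<Sum>j<3 * n. complex_of_real (real s ^ j) * a $ j) ?V"
    using separating_step_exists[OF finite_cp_variety[OF f D0] V] by blast
  have first: "(map_mat of_real (step_matrix (3 * n) s) *\<^sub>v x) $ 0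
      = (\<Sum>j<3 * n. complex_of_real (real s ^ j) * x $ j)" if "x \<in> ?V" for x
    using that V n by (auto simp: scalar_prod_def step_matrix_def lessThan_atLeast0 intro!: sum.cong)
  have "inj_on (\<lambda>a. a $ 0) (step_variety n f s)"
  proof (rule inj_onI)
    fix y y' assume "y \<in> step_variety n f s" "y' \<in> step_variety n f s" and eq: "y $ 0 = y' $ 0"
    then obtain x x' where x: "x \<in> ?V" "x' \<in> ?V" "y = map_mat of_real (step_matrix (3 * n) s) *\<^sub>v x"
      "y' = map_mat of_real (step_matrix (3 * n) s) *\<^sub>v x'"
      by (auto simp: step_variety_eq_image[OF f])
    then have "x = x'" using eq first[OF x(1)] first[OF x(2)] inj_onD[OF s _ x(1,2)] by simp
    then show "y = y'" using x by simp
  qed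
  then show ?thesis using has_shape_iff_separating[OF assms] by blast
qed

lemma algorithm_A_eq_Some:
  assumes n: "n \<ge> 1" and f: "polynomial_mapping n f" and D0: "D0 n f"
  obtains s w us where "has_shape (3 * n) (step_basis n f s) (w, us)"
    "algorithm_A n f = Some (w, output_polys n s us)"
proof -
  let ?b = "\<lambda>s. \<nexists>wu. has_shape (3 * n) (step_basis n f s) wu"
  have "((\<lambda>s. s + 1) ^^ k) (0::nat) = k" for k
    by (induction k) auto
  then have "\<exists>k. \<not> ?b (((\<lambda>s. s + 1) ^^ k) 0)"
    using some_step_has_shape[OF assms] by simp
  then obtain s where s: "while_option ?b (\<lambda>s. s + 1) 0 = Some s"
    unfolding while_option_def by simp
  then have "\<not> ?b s" by (rule while_option_stop)
  then obtain w us where shape: "has_shape (3 * n) (step_basis n f s) (w, us)" by auto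
  have "(THE wu. has_shape (3 * n) (step_basis n f s) wu) = (w, us)"
  proof (rule the_equality)
    show "has_shape (3 * n) (step_basis n f s) (w, us)" by (rule shape)
    fix wu assume "has_shape (3 * n) (step_basis n f s) wu"
    then show "wu = (w, us)"
      using has_shape_unique[OF _ shape, of "fst wu" "snd wu"] by (cases wu) auto
  qed
  then have "algorithm_A n f = Some (w, output_polys n s us)"
    by (simp only: algorithm_A_def s option.map Let_def prod.case)
  with shape show ?thesis by (rule that)
qed

lemma Sol_iff:
  "x \<in> Sol n f \<longleftrightarrow> x \<in> carrier_vec n \<and>
    (\<forall>i<n. x $ i \<ge> 0 \<and> real_eval (f i) x \<ge> 0 \<and> x $ i * real_eval (f i) x = 0)"
proof -
  have "x \<bullet> vec n (\<lambda>i. real_eval (f i) x) = (\<Sum>i<n. x $ i * real_eval (f i) x)" if "x \<in> carrier_vec n"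
    using that by (simp add: scalar_prod_def lessThan_atLeast0)
  moreover have "(\<Sum>i<n. x $ i * real_eval (f i) x) = 0 \<longleftrightarrow> (\<forall>i<n. x $ i * real_eval (f i) x = 0)"
    if "\<forall>i<n. x $ i \<ge> 0" "\<forall>i<n. real_eval (f i) x \<ge> 0"
    using that by (subst sum_nonneg_eq_0_iff) auto
  ultimately show ?thesis by (auto simp: Sol_def)
qed

text \<open>A real number is nonnegative iff it is a square of a real number: \<open>z\<^sub>i\<close> and \<open>z\<^sub>n\<^sub>+\<^sub>i\<close> are square
  roots of \<open>x\<^sub>i\<close> and \<open>f\<^sub>i(x)\<close>.\<close>

lemma Sol_eq_real_points:
  assumes f: "polynomial_mapping n f"
  shows "Sol n f = {vec n (\<lambda>i. z $ i) | z. z \<in> carrier_vec (3 * n) \<and> map_vec of_real z \<in> cp_variety n f}"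
proof -
  have fN: "mvars (f i) \<subseteq> {..<n}" if "i < n" for i
    using f that by (simp add: polynomial_mapping_def)
  have real_point: "map_vec of_real z \<in> cp_variety n f \<longleftrightarrow>
      (\<forall>i<n. z $ i * real_eval (f i) z = 0 \<and> (z $ (n + i))\<^sup>2 = z $ i \<and> (z $ (2 * n + i))\<^sup>2 = real_eval (f i) z)"
    if z: "z \<in> carrier_vec (3 * n)" for z
  proof -
    have "complex_eval (f i) (map_vec of_real z) = of_real (real_eval (f i) z)" if "i < n" for i
      using fN[OF that] z by (intro complex_eval_of_real) auto
    moreover have "of_real a * of_real b = (0::complex) \<longleftrightarrow> a * b = 0"
      "(complex_of_real a)\<^sup>2 = of_real b \<longleftrightarrow> a\<^sup>2 = b" for a b :: real
      by (simp_all flip: of_real_power of_real_mult)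
    ultimately show ?thesis using z unfolding cp_variety_iff[OF f] by auto
  qed
  show ?thesis
  proof (intro equalityI subsetI)
    fix x assume x: "x \<in> Sol n f"
    define z where "z = vec (3 * n) (\<lambda>j. if j < n then x $ j else if j < 2 * n then sqrt (x $ (j - n))
      else sqrt (real_eval (f (j - 2 * n)) x))"
    have zc: "z \<in> carrier_vec (3 * n)" by (simp add: z_def)
    have zi: "z $ i = x $ i" "z $ (n + i) = sqrt (x $ i)" "z $ (2 * n + i) = sqrt (real_eval (f i) x)"
      if "i < n" for i
      using that by (auto simp: z_def)
    have fz: "real_eval (f i) z = real_eval (f i) x" if "i < n" for i
      using fN[OF that] zi(1) by (rule real_eval_first_vars)
    have "map_vec of_real z \<in> cp_variety n f"
      using x zi fz unfolding real_point[OF zc] by (simp add: Sol_iff)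
    moreover have "x = vec n (\<lambda>i. z $ i)"
      using x zi(1) by (intro eq_vecI) (simp_all add: Sol_iff)
    ultimately show "x \<in> {vec n (\<lambda>i. z $ i) | z. z \<in> carrier_vec (3 * n) \<and> map_vec of_real z \<in> cp_variety n f}"
      using zc by (intro CollectI exI[of _ z] conjI)
  next
    fix x assume "x \<in> {vec n (\<lambda>i. z $ i) | z. z \<in> carrier_vec (3 * n) \<and> map_vec of_real z \<in> cp_variety n f}"
    then obtain z where z: "x = vec n (\<lambda>i. z $ i)" "z \<in> carrier_vec (3 * n)" "map_vec of_real z \<in> cp_variety n f"
      by auto
    have fz: "real_eval (f i) x = real_eval (f i) z" if "i < n" for i
      using fN[OF that] z(1) by (intro real_eval_first_vars[of _ n]) auto
    have "0 \<le> z $ i \<and> 0 \<le> real_eval (f i) z \<and> z $ i * real_eval (f i) z = 0" if "i < n" for i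
    proof -
      have "z $ i * real_eval (f i) z = 0" "(z $ (n + i))\<^sup>2 = z $ i" "(z $ (2 * n + i))\<^sup>2 = real_eval (f i) z"
        using z(3) that unfolding real_point[OF z(2)] by auto
      then show ?thesis
        using zero_le_power2[of "z $ (n + i)"] zero_le_power2[of "z $ (2 * n + i)"] by simp
    qed
    then show "x \<in> Sol n f" using z(1) fz by (auto simp: Sol_iff)
  qed
qed

lemma output_polys_nth:
  assumes "i < n" "length us = 3 * n - 1"
  shows "output_polys n s us ! i = (\<Sum>j<3 * n. [:H_matrix (3 * n) s $$ (i, j):] * ([:0, 1:] # us) ! j)"
  using assms H_matrix_inverse(1)[of "3 * n" s]
  by (auto simp: output_polys_def scalar_prod_def lessThan_atLeast0 vec_of_list_index simp del: vec_of_list_Cons intro!: sum.cong)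

text \<open>The degree bound has the form \<open>max 2 (degree w)\<close> since an output polynomial is a linear combination of the
  \<open>u\<^sub>j\<close>, of degree below \<open>degree w\<close>, and of \<open>t\<close>, of degree one. It amounts to \<open>degree w\<close> unless the
  variety is a single point.\<close>

theorem output_represents_Sol:
  assumes n: "n \<ge> 1" and f: "polynomial_mapping n f" and D0: "D0 n f"
    and shape: "has_shape (3 * n) (step_basis n f s) (w, us)"
  shows "degree w = card (cp_variety n f)"
    and "\<And>i. i < n \<Longrightarrow> degree (output_polys n s us ! i) < max 2 (degree w)"
    and "Sol n f = {vec n (\<lambda>i. poly (output_polys n s us ! i) t) | t. poly w t = 0}"
proof -
  let ?N = "3 * n" and ?H = "H_matrix (3 * n) s" and ?M = "step_matrix (3 * n) s"
  let ?V = "step_variety n f s"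
  note V = step_variety_props[OF f D0, of s]
  have N: "?N \<ge> 1" using n by simp
  have sep: "inj_on (\<lambda>a. a $ 0) ?V"
    using has_shape_iff_separating[OF n f D0] shape by blast
  obtain w' us' where *: "length us' = ?N - 1" "degree w' = card ?V"
    "\<And>t. poly (map_poly of_real w') t = 0 \<longleftrightarrow> t \<in> (\<lambda>a. a $ 0) ` ?V"
    "\<And>j. j < ?N - 1 \<Longrightarrow> degree (us' ! j) < card ?V"
    "\<And>j a. j < ?N - 1 \<Longrightarrow> a \<in> ?V \<Longrightarrow> a $ (j + 1) = poly (map_poly of_real (us' ! j)) (a $ 0)"
    "has_shape ?N (step_basis n f s) (w', us')"
    unfolding step_basis_eq[OF f] using shape_lemma[OF V(1-4) N sep] by metis
  have eq: "w' = w" "us' = us" using has_shape_unique[OF *(6) shape] by auto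
  note len = *(1)[unfolded eq] and deg_w = *(2)[unfolded eq] and roots = *(3)[unfolded eq]
    and deg_u = *(4)[unfolded eq] and coord = *(5)[unfolded eq]
  show "degree w = card (cp_variety n f)" using deg_w V(5) by simp
  let ?q = "\<lambda>j. ([:0, 1:] # us) ! j"
  have out: "output_polys n s us ! i = (\<Sum>j<?N. [:?H $$ (i, j):] * ?q j)" if "i < n" for i
    by (rule output_polys_nth[OF that len])
  have deg_q: "degree (?q j) \<le> max 1 (degree w - 1)" if "j < ?N" for j
  proof (cases j)
    case (Suc k)
    then have "degree (us ! k) < degree w" using that deg_u[of k] deg_w by simp
    then show ?thesis using Suc by auto
  qed simp
  show "degree (output_polys n s us ! i) < max 2 (degree w)" if "i < n" for i
  proof -
    have "degree (output_polys n s us ! i) \<le> max 1 (degree w - 1)"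
      unfolding out[OF that] using deg_q
      by (intro degree_sum_le) (auto intro: order_trans[OF degree_smult_le])
    then show ?thesis by auto
  qed
  \<comment> \<open>\<open>Y t\<close> is the point \<open>(t, u\<^sub>2(t), \<dots>, u\<^sub>N(t))\<close> on the curve that carries the transformed variety.\<close>
  define Y where "Y t = vec ?N (\<lambda>j. poly (?q j) t)" for t
  have Y: "Y t \<in> carrier_vec ?N" for t by (simp add: Y_def)
  have HY: "poly (output_polys n s us ! i) t = (?H *\<^sub>v Y t) $ i" if "i < n" for i t
    unfolding out[OF that] using that H_matrix_inverse(1)[of ?N s]
    by (auto simp: Y_def poly_sum scalar_prod_def lessThan_atLeast0 intro!: sum.cong)
  have point: "a = map_vec of_real (Y t)" if a: "a \<in> ?V" "a $ 0 = of_real t" for a t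
  proof (rule eq_vecI)
    have "dim_vec a = ?N" using a(1) V(3) by (meson carrier_vecD subsetD)
    then show "dim_vec a = dim_vec (map_vec complex_of_real (Y t))" by (simp add: Y_def)
    fix i assume "i < dim_vec (map_vec complex_of_real (Y t))"
    then have "i < ?N" by (simp add: Y_def)
    then show "a $ i = map_vec complex_of_real (Y t) $ i"
      using a(2) coord[OF _ a(1), of "i - 1"] by (cases i) (auto simp: Y_def poly_of_real)
  qed
  have real_points: "z \<in> carrier_vec ?N \<and> map_vec of_real z \<in> cp_variety n f \<longleftrightarrow> (\<exists>t. poly w t = 0 \<and> z = ?H *\<^sub>v Y t)" for z
  proof
    assume z: "z \<in> carrier_vec ?N \<and> map_vec of_real z \<in> cp_variety n f"
    define y where "y = ?M *\<^sub>v z"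
    have yc: "y \<in> carrier_vec ?N"
      unfolding y_def using z by (intro mult_mat_vec_carrier[OF step_matrix_carrier]) blast
    have "map_vec complex_of_real y = map_mat of_real ?M *\<^sub>v map_vec of_real z"
      unfolding y_def using z by (intro of_real_mult_mat_vec[symmetric, OF step_matrix_carrier]) blast
    then have yV: "map_vec of_real y \<in> ?V"
      using z unfolding step_variety_eq_image[OF f] by (intro image_eqI) auto
    have y0: "map_vec of_real y $ 0 = complex_of_real (y $ 0)" using yc n by simp
    have "complex_of_real (y $ 0) \<in> (\<lambda>a. a $ 0) ` ?V"
      using yV y0 by (intro image_eqI[where x = "map_vec of_real y"]) simp_all
    then have "poly (map_poly of_real w) (complex_of_real (y $ 0)) = 0" by (simp only: roots)
    then have "poly w (y $ 0) = 0" by (simp add: poly_of_real)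
    moreover have "z = ?H *\<^sub>v Y (y $ 0)"
    proof -
      have "map_vec complex_of_real y = map_vec of_real (Y (y $ 0))"
        by (rule point[OF yV y0])
      then have "y = Y (y $ 0)" by (rule of_real_hom.vec_hom_inj)
      moreover have "?H *\<^sub>v y = (?H * ?M) *\<^sub>v z"
        unfolding y_def using z
        by (intro assoc_mult_mat_vec[symmetric, OF H_matrix_inverse(1) step_matrix_carrier]) blast
      moreover have "(?H * ?M) *\<^sub>v z = z" using z by (simp add: H_matrix_inverse(3))
      ultimately show ?thesis by simp
    qed
    ultimately show "\<exists>t. poly w t = 0 \<and> z = ?H *\<^sub>v Y t" by blast
  next
    assume "\<exists>t. poly w t = 0 \<and> z = ?H *\<^sub>v Y t"
    then obtain t where t: "poly w t = 0" "z = ?H *\<^sub>v Y t" by blast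
    have "poly (map_poly of_real w) (complex_of_real t) = 0" using t by (simp add: poly_of_real)
    then obtain a where a: "a \<in> ?V" "a $ 0 = of_real t" unfolding roots by force
    have "map_mat of_real ?H *\<^sub>v a \<in> cp_variety n f" using a(1) by (simp add: step_variety_iff[OF f])
    then have "map_vec of_real z \<in> cp_variety n f"
      unfolding point[OF a] t(2) by (simp add: of_real_mult_mat_vec[OF H_matrix_inverse(1) Y])
    moreover have "z \<in> carrier_vec ?N"
      unfolding t(2) by (rule mult_mat_vec_carrier[OF H_matrix_inverse(1) Y])
    ultimately show "z \<in> carrier_vec ?N \<and> map_vec of_real z \<in> cp_variety n f" by blast
  qed
  have "vec n (\<lambda>i. poly (output_polys n s us ! i) t) = vec n (\<lambda>i. (?H *\<^sub>v Y t) $ i)" for t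
    using HY by (intro eq_vecI) auto
  then show "Sol n f = {vec n (\<lambda>i. poly (output_polys n s us ! i) t) | t. poly w t = 0}"
    unfolding Sol_eq_real_points[OF f] real_points by auto
qed

theorem theorem5p1:
  fixes n :: nat and f :: "nat \<Rightarrow> real mpoly"
  assumes "n \<ge> 1"
    and "polynomial_mapping n f"
    and "D0 n f"
  shows "\<exists>w vs. algorithm_A n f = Some (w, vs) \<and>
    (card (cp_variety n f) \<noteq> 1 \<longrightarrow> univariate_representation n f w vs) \<and>
    (card (cp_variety n f) = 1 \<longrightarrow> univariate_representation n f w (map (\<lambda>v. v mod w) vs))"
proof -
  obtain s w us where shape: "has_shape (3 * n) (step_basis n f s) (w, us)"
    and result: "algorithm_A n f = Some (w, output_polys n s us)"
    using algorithm_A_eq_Some[OF assms] by blast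
  let ?vs = "output_polys n s us"
  note rep = output_represents_Sol[OF assms shape]
  have len: "length ?vs = n" by (simp add: output_polys_def)
  have card: "card (cp_variety n f) > 0"
    using finite_cp_variety[OF assms(2,3)] cp_variety_nonempty[OF assms(2)] by (simp add: card_gt_0_iff)
  have "univariate_representation n f w ?vs" if "card (cp_variety n f) \<noteq> 1"
  proof -
    have "max 2 (degree w) = degree w" using that card rep(1) by simp
    then show ?thesis
      unfolding univariate_representation_def using len rep(1,3) rep(2) by simp
  qed
  moreover have "univariate_representation n f w (map (\<lambda>v. v mod w) ?vs)"
  proof -
    have "poly (v mod w) t = poly v t" if "poly w t = 0" for v t
    proof -
      have "poly v t = poly (v div w * w + v mod w) t" by simp
      then show ?thesis using that by (simp only: poly_add poly_mult)
    qed
    then have "vec n (\<lambda>i. poly (map (\<lambda>v. v mod w) ?vs ! i) t) = vec n (\<lambda>i. poly (?vs ! i) t)"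
      if "poly w t = 0" for t
      using that len by (intro eq_vecI) auto
    then have "Sol n f = {vec n (\<lambda>i. poly (map (\<lambda>v. v mod w) ?vs ! i) t) | t. poly w t = 0}"
      unfolding rep(3) by (intro Collect_cong ex_cong1) auto
    moreover have "degree (v mod w) < degree w" for v
    proof -
      have "w \<noteq> 0" using card rep(1) by auto
      then show ?thesis using degree_mod_less[of w v] card rep(1) by auto
    qed
    ultimately show ?thesis
      unfolding univariate_representation_def using len rep(1) by simp
  qed
  ultimately show ?thesis using result by blast
qed

end
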